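(* Let $n\ge3$, $m\ge2$, and let $f_i:\mathbb{R}^n\to\mathbb{R}$, $f_i(x)=x^\top A_ix+2b_i^\top x+c_i$, $i\in[m]$, be quadratic functions. Let $S=\{x\in\mathbb{R}^n:f_i(x)<0,\ i\in[m]\}$. Assume $S\ne\emptyset$, $\mathrm{conv}(S)\ne\mathbb{R}^n$, and that hidden hyperplane convexity holds for the associated homogeneous quadratic map $f^h$ (so that $\mathrm{conv}(S)=\bigcap_{\lambda\in\Omega_1}S_\lambda$). Furthermore assume that for all distinct $i,j,k\in[m]$ there exist scalars $p_{ijk},q_{ijk},r_{ijk}\in\mathbb{R}$ such that $p_{ijk}Q_i+q_{ijk}Q_j+r_{ijk}Q_k\succ0$. Then there exist $r\le m^2-m$ and $\lambda^{(1)},\ldots,\lambda^{(r)}\in\Omega_2$ such that $$\mathrm{conv}(S)=\bigcap_{i=1}^rS_{\lambda^{(i)}}.$$ Moreover, for any $u,v\in[m]$ with $u\ne v$, there are at most two of the $\lambda^{(i)}$ with support $\{u,v\}$, and these can be written as $\alpha'e_u+(1-\alpha')e_v$ and $\alpha''e_u+(1-\alpha'')e_v$, where $\alpha',\alpha''$ are roots of $\det(\alpha Q_u+(1-\alpha)Q_v)=0$ (in the variable $\alpha$).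
   Context: $[m]=\{1,\dots,m\}$; $A_i$ are symmetric real $n\times n$ matrices, $b_i\in\mathbb{R}^n$, $c_i\in\mathbb{R}$; $Q_i=\begin{bmatrix}A_i & b_i\\ b_i^\top & c_i\end{bmatrix}$; $e_i$ is the $i$-th standard basis vector of $\mathbb{R}^m$; the support of $\lambda\in\mathbb{R}^m_+$ is $\{i:\lambda_i>0\}$. The associated homogeneous quadratic map is $f^h:\mathbb{R}^{n+1}\to\mathbb{R}^m$, $f^h(\hat x)=(\hat x^\top Q_1\hat x,\ldots,\hat x^\top Q_m\hat x)$; it satisfies hidden hyperplane convexity if for every linear hyperplane $H\subseteq\mathbb{R}^{n+1}$ the set $\{f^h(\hat x):\hat x\in H\}$ is convex. For $\lambda\in\mathbb{R}^m_+$ (nonnegative orthant): $Q_\lambda=\sum_{i=1}^m\lambda_iQ_i$ and $S_\lambda=\{x\in\mathbb{R}^n:\sum_{i=1}^m\lambda_if_i(x)<0\}$. $\Omega=\{\lambda\in\mathbb{R}^m_+\setminus\{0\}: \mathrm{conv}(S)\subseteq S_\lambda$ and $Q_\lambda$ has at most one negative eigenvalue$\}$; $\Omega_1=\Omega\setminus\{\lambda\in\Omega:S_\lambda=\mathbb{R}^n\}$; $\Omega_2=\{\lambda\in\Omega_1:|\{i:\lambda_i>0\}|\le2\}$. *)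

theory Defs
  imports "HOL-Analysis.Analysis"
begin

definition quad_fun :: "real^'n^'n \<Rightarrow> real^'n \<Rightarrow> real \<Rightarrow> real^'n \<Rightarrow> real" where
  "quad_fun A b c x = x \<bullet> (A *v x) + 2 * (b \<bullet> x) + c"

text \<open>
  The space \<open>\<real>\<^bsup>n+1\<^esup>\<close> is \<open>real ^ ('n option)\<close>: the indices \<open>Some i\<close> are the original
  coordinates and \<open>None\<close> is the additional homogenizing one.
\<close>

definition hom_mat ::
  "real^'n^'n \<Rightarrow> real^'n \<Rightarrow> real \<Rightarrow> real^('n::finite option)^('n option)" where
  "hom_mat A b c = (\<chi> i j.
     case i of
       Some k \<Rightarrow> (case j of Some l \<Rightarrow> A $ k $ l | None \<Rightarrow> b $ k)
     | None \<Rightarrow> (case j of Some l \<Rightarrow> b $ l | None \<Rightarrow> c))"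

definition pos_definite :: "real^'k^'k \<Rightarrow> bool" where
  "pos_definite M \<longleftrightarrow> transpose M = M \<and> (\<forall>x. x \<noteq> 0 \<longrightarrow> x \<bullet> (M *v x) > 0)"

definition eigenspace :: "real^'k^'k \<Rightarrow> real \<Rightarrow> (real^'k) set" where
  "eigenspace M \<mu> = {x. M *v x = \<mu> *\<^sub>R x}"

definition neg_eigenvalues :: "real^'k^'k \<Rightarrow> real set" where
  "neg_eigenvalues M = {\<mu>. \<mu> < 0 \<and> (\<exists>x. x \<noteq> 0 \<and> M *v x = \<mu> *\<^sub>R x)}"

text \<open>
  Eigenvalues are counted with multiplicity. This is only used for symmetric matrices, where
  geometric and algebraic multiplicities agree and the index set of the sum is finite
  (see \<open>finite_neg_eigenvalues\<close> below).
\<close>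

definition num_neg_eigenvalues :: "real^'k^'k \<Rightarrow> nat" where
  "num_neg_eigenvalues M = (\<Sum>\<mu>\<in>neg_eigenvalues M. dim (eigenspace M \<mu>))"

lemma finite_neg_eigenvalues:
  fixes M :: "real^'k^'k"
  assumes sym: "transpose M = M"
  shows "finite (neg_eigenvalues M)"
proof -
  have "\<exists>v. \<forall>\<mu>\<in>neg_eigenvalues M. v \<mu> \<noteq> 0 \<and> M *v v \<mu> = \<mu> *\<^sub>R v \<mu>"
    by (intro bchoice) (auto simp: neg_eigenvalues_def)
  then obtain v where
    v: "\<And>\<mu>. \<mu> \<in> neg_eigenvalues M \<Longrightarrow> v \<mu> \<noteq> 0 \<and> M *v v \<mu> = \<mu> *\<^sub>R v \<mu>"
    by blast
  have swap: "x \<bullet> (M *v y) = (M *v x) \<bullet> y" for x y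
    by (metis dot_lmul_matrix sym transpose_matrix_vector)
  have orth: "v s \<bullet> v t = 0"
    if "s \<in> neg_eigenvalues M" "t \<in> neg_eigenvalues M" "s \<noteq> t" for s t
    using swap[of "v s" "v t"] v that by simp
  have inj: "inj_on v (neg_eigenvalues M)"
    by (rule inj_onI) (metis orth v inner_eq_zero_iff)
  have "pairwise orthogonal (v ` neg_eigenvalues M)"
    by (auto simp: pairwise_def orthogonal_def intro: orth)
  moreover have "0 \<notin> v ` neg_eigenvalues M"
    using v by force
  ultimately have "finite (v ` neg_eigenvalues M)"
    using pairwise_orthogonal_independent independent_bound_general by blast
  then show ?thesis
    using inj finite_imageD by blast
qed

definition support :: "real^'m \<Rightarrow> 'm set" where
  "support l = {i. l $ i > 0}"

text \<open>
  In the definitions below the triple \<open>A\<close>, \<open>b\<close>, \<open>c\<close> is the data of the quadratic functions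
  \<open>f\<^sub>i x = x\<^sup>T A\<^sub>i x + 2 b\<^sub>i\<^sup>T x + c\<^sub>i\<close>, indexed by the finite type \<open>'m\<close>.
\<close>

definition hom_quad_map ::
  "('m \<Rightarrow> real^'n^'n) \<Rightarrow> ('m \<Rightarrow> real^'n) \<Rightarrow> ('m \<Rightarrow> real) \<Rightarrow> real^('n::finite option) \<Rightarrow> real^'m" where
  "hom_quad_map A b c z = (\<chi> i. z \<bullet> (hom_mat (A i) (b i) (c i) *v z))"

definition hidden_hyperplane_convex ::
  "(real^'k \<Rightarrow> real^'m) \<Rightarrow> bool" where
  "hidden_hyperplane_convex F \<longleftrightarrow>
     (\<forall>H. subspace H \<and> dim H + 1 = CARD('k) \<longrightarrow> convex (F ` H))"

definition sol_set ::
  "('m::finite \<Rightarrow> real^'n^'n) \<Rightarrow> ('m \<Rightarrow> real^'n) \<Rightarrow> ('m \<Rightarrow> real) \<Rightarrow> (real^'n) set" where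
  "sol_set A b c = {x. \<forall>i. quad_fun (A i) (b i) (c i) x < 0}"

definition agg_mat ::
  "('m::finite \<Rightarrow> real^'n^'n) \<Rightarrow> ('m \<Rightarrow> real^'n) \<Rightarrow> ('m \<Rightarrow> real) \<Rightarrow> real^'m \<Rightarrow>
     real^('n::finite option)^('n option)" where
  "agg_mat A b c l = (\<Sum>i\<in>UNIV. l $ i *\<^sub>R hom_mat (A i) (b i) (c i))"

definition agg_set ::
  "('m::finite \<Rightarrow> real^'n^'n) \<Rightarrow> ('m \<Rightarrow> real^'n) \<Rightarrow> ('m \<Rightarrow> real) \<Rightarrow> real^'m \<Rightarrow> (real^'n) set" where
  "agg_set A b c l = {x. (\<Sum>i\<in>UNIV. l $ i * quad_fun (A i) (b i) (c i) x) < 0}"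

definition Omega ::
  "('m::finite \<Rightarrow> real^'n^'n) \<Rightarrow> ('m \<Rightarrow> real^'n) \<Rightarrow> ('m \<Rightarrow> real) \<Rightarrow> (real^'m) set" where
  "Omega A b c = {l. (\<forall>i. 0 \<le> l $ i) \<and> l \<noteq> 0 \<and>
     convex hull (sol_set A b c) \<subseteq> agg_set A b c l \<and>
     num_neg_eigenvalues (agg_mat A b c l) \<le> 1}"

definition Omega1 ::
  "('m::finite \<Rightarrow> real^'n^'n) \<Rightarrow> ('m \<Rightarrow> real^'n) \<Rightarrow> ('m \<Rightarrow> real) \<Rightarrow> (real^'m) set" where
  "Omega1 A b c = Omega A b c - {l \<in> Omega A b c. agg_set A b c l = UNIV}"

definition Omega2 ::
  "('m::finite \<Rightarrow> real^'n^'n) \<Rightarrow> ('m \<Rightarrow> real^'n) \<Rightarrow> ('m \<Rightarrow> real) \<Rightarrow> (real^'m) set" where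
  "Omega2 A b c = {l \<in> Omega1 A b c. card (support l) \<le> 2}"

end

theory Submission
  imports Defs
begin

text \<open>
  Write \<open>x' = (x, 1)\<close> (the vector \<open>homog x\<close>), so that \<open>f\<^sub>i x = x'\<^sup>T Q\<^sub>i x'\<close>. Everything rests on
  a certificate for membership in \<open>\<Omega>\<close> (\<open>Omega_iff\<close>): a nonzero \<open>\<lambda> \<ge> 0\<close> lies in \<open>\<Omega>\<close> if and only if some linear
  functional \<open>h\<close> satisfies \<open>h \<bullet> x' > 0\<close> on \<open>S\<close> and \<open>Q\<^sub>\<lambda>\<close> is positive semidefinite on the hyperplane
  \<open>h\<^sup>\<bottom>\<close>. The functional singles out one of the two opposite convex cones that make up
  \<open>{z. z\<^sup>T Q\<^sub>\<lambda> z < 0}\<close>, and the condition says that \<open>S\<close> lies in that one cone.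

  Let \<open>y\<close> be outside the open convex set \<open>conv S\<close>. A separating hyperplane yields \<open>h\<close> that is
  positive on \<open>S\<close> and vanishes at \<open>y'\<close>. No point of \<open>h\<^sup>\<bottom>\<close> makes all \<open>Q\<^sub>i\<close> negative, so the image of
  \<open>h\<^sup>\<bottom>\<close> under the homogeneous quadratic map, which is convex, can be separated from the open
  negative orthant. The separating vector is a \<open>\<lambda> \<ge> 0\<close> with \<open>Q\<^sub>\<lambda>\<close> semidefinite on
  \<open>h\<^sup>\<bottom>\<close> (\<open>exists_separating_aggregation\<close>); it is in \<open>\<Omega>\<close>, and it cuts off \<open>y\<close> because
  \<open>y' \<in> h\<^sup>\<bottom>\<close>.

  Adding to \<open>\<lambda>\<close> a positive multiple of a definite combination of three matrices in its support keeps
  \<open>Q\<^sub>\<lambda>\<close> semidefinite on \<open>h\<^sup>\<bottom>\<close>. Such a combination has a negative coefficient, since all \<open>f\<^sub>i\<close> are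
  negative on \<open>S\<close>; hence one can move until a coordinate of \<open>\<lambda>\<close> vanishes, and repeat until at most two
  are left (\<open>reduce_support\<close>).

  It remains to treat one pair \<open>u \<noteq> v\<close>. The parameters \<open>\<alpha> \<in> [0, 1]\<close> with
  \<open>\<alpha> e\<^sub>u + (1 - \<alpha>) e\<^sub>v \<in> \<Omega>\<close> form a compact set, because certificates can be normalized to unit length
  (\<open>compact_Omega_segment\<close>). The value of the aggregated function at \<open>y\<close> is affine in \<open>\<alpha>\<close>, so whenever
  some parameter cuts off \<open>y\<close>, the least or the greatest one does. Two aggregations per pair suffice,
  which gives at most \<open>m\<^sup>2 - m\<close>. If the aggregated matrix at an extreme parameter inside \<open>(0, 1)\<close>
  were nonsingular, it would be definite on a suitable certifying hyperplane, and all nearby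
  parameters would have the same certificate (\<open>Omega_segment_nonsingular_interior\<close>), contradicting
  extremality; so its determinant vanishes.
\<close>

section \<open>Quadratic forms on hyperplanes\<close>

lemma symmetric_inner:
  fixes M :: "real^'k^'k"
  assumes "transpose M = M"
  shows "x \<bullet> (M *v y) = y \<bullet> (M *v x)"
  by (metis assms dot_lmul_matrix inner_commute transpose_matrix_vector)

lemma quadratic_form_lincomb:
  fixes M :: "real^'k^'k"
  assumes "transpose M = M"
  shows "(a *\<^sub>R x + b *\<^sub>R y) \<bullet> (M *v (a *\<^sub>R x + b *\<^sub>R y))
           = a\<^sup>2 * (x \<bullet> (M *v x)) + 2 * a * b * (x \<bullet> (M *v y)) + b\<^sup>2 * (y \<bullet> (M *v y))"
  using symmetric_inner[OF assms, of x y]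
  by (simp add: matrix_vector_right_distrib matrix_vector_mult_scaleR
      inner_add_left inner_add_right algebra_simps power2_eq_square)

text \<open>
  Here \<open>t y + x\<close> has the form value
  \<open>t\<^sup>2 (y\<^sup>T M y) + 2 t (y\<^sup>T M x)\<close>, which becomes negative for small \<open>t\<close> of the right sign unless
  \<open>y\<^sup>T M x = 0\<close>.
\<close>

lemma semidefinite_form_null_vector:
  fixes M :: "real^'k^'k"
  assumes sym: "transpose M = M" and V: "subspace V"
    and nonneg: "\<And>z. z \<in> V \<Longrightarrow> 0 \<le> z \<bullet> (M *v z)"
    and x: "x \<in> V" "x \<bullet> (M *v x) = 0" and y: "y \<in> V"
  shows "y \<bullet> (M *v x) = 0"
proof (rule ccontr)
  define B where "B = y \<bullet> (M *v x)"
  define q where "q = y \<bullet> (M *v y)"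
  define t where "t = - B / (q + 1)"
  assume "y \<bullet> (M *v x) \<noteq> 0"
  then have B: "B \<noteq> 0" by (simp add: B_def)
  have q: "q \<ge> 0" using nonneg[OF y] by (simp add: q_def)
  have "t *\<^sub>R y + 1 *\<^sub>R x \<in> V"
    using V x(1) y by (simp add: subspace_add subspace_scale)
  from nonneg[OF this] have "0 \<le> t\<^sup>2 * q + 2 * t * B"
    unfolding quadratic_form_lincomb[OF sym] by (simp add: x(2) q_def B_def)
  also have "\<dots> = - (B\<^sup>2 * (q + 2)) / (q + 1)\<^sup>2"
  proof -
    have "q + 1 \<noteq> 0" using q by simp
    then show ?thesis by (simp add: t_def divide_simps) algebra
  qed
  also have "\<dots> < 0" using B q by (intro divide_neg_pos) simp_all
  finally show False by simp
qed

definition psd_on_hyperplane :: "real^'k^'k \<Rightarrow> real^'k \<Rightarrow> bool" where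
  "psd_on_hyperplane M h \<longleftrightarrow> (\<forall>z. h \<bullet> z = 0 \<longrightarrow> 0 \<le> z \<bullet> (M *v z))"

text \<open>
  Otherwise the form would be negative at the combination \<open>z - t w\<close>, \<open>t > 0\<close>, that lies in the
  hyperplane. This inequality plays the role that the reverse Cauchy-Schwarz inequality has for
  time-like vectors in a Lorentzian form, and it makes the negative cone on one side convex.
\<close>

lemma reverse_Cauchy_Schwarz:
  fixes M :: "real^'k^'k"
  assumes sym: "transpose M = M" and psd: "psd_on_hyperplane M h"
    and z: "h \<bullet> z > 0" "z \<bullet> (M *v z) < 0" and w: "h \<bullet> w > 0" "w \<bullet> (M *v w) < 0"
  shows "z \<bullet> (M *v w) < 0"
proof (rule ccontr)
  assume c: "\<not> z \<bullet> (M *v w) < 0"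
  define t where "t = h \<bullet> z / (h \<bullet> w)"
  have t: "t > 0" using z w by (simp add: t_def)
  have "h \<bullet> (1 *\<^sub>R z + (- t) *\<^sub>R w) = 0"
    using w by (simp add: t_def inner_diff_right)
  then have "0 \<le> z \<bullet> (M *v z) - 2 * t * (z \<bullet> (M *v w)) + t\<^sup>2 * (w \<bullet> (M *v w))"
    using psd[unfolded psd_on_hyperplane_def, rule_format, of "1 *\<^sub>R z + (- t) *\<^sub>R w"]
    unfolding quadratic_form_lincomb[OF sym] by simp
  moreover have "t * (z \<bullet> (M *v w)) \<ge> 0" using t c by simp
  moreover have "t\<^sup>2 * (w \<bullet> (M *v w)) \<le> 0" using w by (simp add: mult_nonneg_nonpos)
  ultimately show False using z by linarith
qed

lemma convex_negative_half_cone: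
  fixes M :: "real^'k^'k"
  assumes sym: "transpose M = M" and psd: "psd_on_hyperplane M h"
  shows "convex {z. h \<bullet> z > 0 \<and> z \<bullet> (M *v z) < 0}"
proof (rule convexI, clarify)
  fix z w :: "real^'k" and a b :: real
  assume z: "h \<bullet> z > 0" "z \<bullet> (M *v z) < 0" and w: "h \<bullet> w > 0" "w \<bullet> (M *v w) < 0"
    and ab: "0 \<le> a" "0 \<le> b" "a + b = 1"
  have zw: "z \<bullet> (M *v w) < 0"
    using reverse_Cauchy_Schwarz[OF sym psd z w] .
  consider "a = 0" "b = 1" | "a > 0" using ab by fastforce
  then show "0 < h \<bullet> (a *\<^sub>R z + b *\<^sub>R w) \<and>
      (a *\<^sub>R z + b *\<^sub>R w) \<bullet> (M *v (a *\<^sub>R z + b *\<^sub>R w)) < 0"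
  proof cases
    case 1 then show ?thesis using w by simp
  next
    case 2
    have "a\<^sup>2 * (z \<bullet> (M *v z)) < 0" using 2 z by (simp add: mult_pos_neg)
    moreover have "2 * a * b * (z \<bullet> (M *v w)) \<le> 0"
      using 2 ab zw by (simp add: mult_nonneg_nonpos)
    moreover have "b\<^sup>2 * (w \<bullet> (M *v w)) \<le> 0" using w by (simp add: mult_nonneg_nonpos)
    moreover have "0 < a * (h \<bullet> z)" "0 \<le> b * (h \<bullet> w)" using 2 z w ab by simp_all
    ultimately show ?thesis
      unfolding quadratic_form_lincomb[OF sym] by (simp add: inner_add_right)
  qed
qed

section \<open>Matrices with at most one negative eigenvalue\<close>

text \<open>
  The part of the spectral theorem that is needed: a minimizer of the form on the unit sphere of an
  invariant subspace is an eigenvector. With \<open>\<mu>\<close> the minimum, \<open>M - \<mu> I\<close> is semidefinite on the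
  subspace and vanishes at the minimizer, so \<open>semidefinite_form_null_vector\<close> applies to it.
\<close>

lemma negative_eigenvector_in_invariant_subspace:
  fixes M :: "real^'k^'k"
  assumes sym: "transpose M = M" and V: "subspace V"
    and inv: "\<And>z. z \<in> V \<Longrightarrow> M *v z \<in> V"
    and x0: "x0 \<in> V" "x0 \<bullet> (M *v x0) < 0"
  obtains x \<mu> where "x \<in> V" "x \<noteq> 0" "\<mu> < 0" "M *v x = \<mu> *\<^sub>R x"
proof -
  let ?K = "sphere 0 1 \<inter> V"
  have scale: "(t *\<^sub>R z) \<bullet> (M *v (t *\<^sub>R z)) = t\<^sup>2 * (z \<bullet> (M *v z))" for t z
    by (simp add: matrix_vector_mult_scaleR power2_eq_square)
  have x0_ne: "x0 \<noteq> 0" using x0 by auto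
  have unit: "(1 / norm z) *\<^sub>R z \<in> ?K" if "z \<in> V" "z \<noteq> 0" for z
    using that V by (simp add: subspace_scale)
  have "compact ?K"
    by (simp add: compact_Int_closed closed_subspace V)
  moreover have "?K \<noteq> {}" using unit[OF x0(1) x0_ne] by blast
  moreover have "continuous_on ?K (\<lambda>z. z \<bullet> (M *v z))"
    by (intro continuous_intros)
  ultimately obtain x where x: "x \<in> ?K"
    and xmin: "\<And>z. z \<in> ?K \<Longrightarrow> x \<bullet> (M *v x) \<le> z \<bullet> (M *v z)"
    using continuous_attains_inf[of ?K "\<lambda>z. z \<bullet> (M *v z)"] by blast
  define \<mu> where "\<mu> = x \<bullet> (M *v x)"
  have low: "\<mu> * (norm z)\<^sup>2 \<le> z \<bullet> (M *v z)" if "z \<in> V" for z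
  proof (cases "z = 0")
    case False
    then have "\<mu> \<le> (1 / norm z)\<^sup>2 * (z \<bullet> (M *v z))"
      using xmin[OF unit[OF that False]] by (simp only: scale \<mu>_def)
    then show ?thesis using False by (simp add: field_simps power2_eq_square)
  qed simp
  have "\<mu> * (norm x0)\<^sup>2 < 0" using low[OF x0(1)] x0(2) by linarith
  then have neg: "\<mu> < 0" by (simp add: mult_less_0_iff)
  define B where "B = M - \<mu> *\<^sub>R mat 1"
  have B: "B *v z = M *v z - \<mu> *\<^sub>R z" for z
    by (simp add: B_def matrix_vector_mult_diff_rdistrib scaleR_matrix_vector_assoc[symmetric])
  have symB: "transpose B = B"
    using sym by (simp add: B_def transpose_def vec_eq_iff mat_def)
  have "x \<bullet> (B *v x) = 0"
    using x by (simp add: B inner_diff_right \<mu>_def dot_square_norm)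
  moreover have "0 \<le> z \<bullet> (B *v z)" if "z \<in> V" for z
    using low[OF that] by (simp add: B inner_diff_right dot_square_norm)
  moreover have "B *v x \<in> V"
    using x V inv by (simp add: B subspace_diff subspace_scale)
  ultimately have "(B *v x) \<bullet> (B *v x) = 0"
    using semidefinite_form_null_vector[OF symB V] x by blast
  then have "M *v x = \<mu> *\<^sub>R x" by (simp add: B)
  moreover have "x \<noteq> 0" using x by auto
  ultimately show ?thesis using that x neg by blast
qed

text \<open>
  This replaces the count with multiplicities by a condition on single pairs of vectors. Distinct
  eigenvalues have orthogonal eigenvectors, and an eigenspace of dimension two contains an
  orthogonal pair, so two negative eigenvalues always come with orthogonal eigenvectors.
\<close>

lemma num_neg_eigenvalues_le_1_iff:
  fixes M :: "real^'k^'k"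
  assumes sym: "transpose M = M"
  shows "num_neg_eigenvalues M \<le> 1 \<longleftrightarrow>
    (\<forall>x y \<mu> \<nu>. \<mu> < 0 \<and> \<nu> < 0 \<and> M *v x = \<mu> *\<^sub>R x \<and> M *v y = \<nu> *\<^sub>R y \<and> x \<bullet> y = 0
        \<longrightarrow> x = 0 \<or> y = 0)"
    (is "_ \<longleftrightarrow> ?R")
proof -
  note fin = finite_neg_eigenvalues[OF sym]
  have sub: "subspace (eigenspace M \<mu>)" for \<mu>
    by (auto simp: eigenspace_def subspace_def matrix_vector_right_distrib
        matrix_vector_mult_scaleR scaleR_add_right)
  have pos: "dim (eigenspace M \<mu>) \<ge> 1" if "x \<noteq> 0" "M *v x = \<mu> *\<^sub>R x" for x \<mu>
  proof -
    have "x \<in> eigenspace M \<mu>" using that by (simp add: eigenspace_def)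
    then have "dim (eigenspace M \<mu>) \<noteq> 0" using that(1) unfolding dim_eq_0 by blast
    then show ?thesis by linarith
  qed
  show ?thesis
  proof
    assume le: "num_neg_eigenvalues M \<le> 1"
    show ?R
    proof (intro allI impI, elim conjE, rule ccontr)
      fix x y \<mu> \<nu>
      assume *: "\<mu> < 0" "\<nu> < 0" "M *v x = \<mu> *\<^sub>R x" "M *v y = \<nu> *\<^sub>R y" "x \<bullet> y = 0"
        and "\<not> (x = 0 \<or> y = 0)"
      then have ne: "x \<noteq> 0" "y \<noteq> 0" by auto
      have mem: "\<mu> \<in> neg_eigenvalues M" "\<nu> \<in> neg_eigenvalues M"
        using * ne by (auto simp: neg_eigenvalues_def)
      show False
      proof (cases "\<mu> = \<nu>")
        case False
        have "(\<Sum>s\<in>{\<mu>, \<nu>}. dim (eigenspace M s)) \<le> num_neg_eigenvalues M"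
          unfolding num_neg_eigenvalues_def using fin mem by (intro sum_mono2) auto
        then show False using le False pos[OF ne(1) *(3)] pos[OF ne(2) *(4)] by simp
      next
        case True
        have "(\<Sum>s\<in>{\<mu>}. dim (eigenspace M s)) \<le> num_neg_eigenvalues M"
          unfolding num_neg_eigenvalues_def using fin mem by (intro sum_mono2) auto
        then have "dim (eigenspace M \<mu>) \<le> 1" using le by simp
        moreover have xy: "x \<noteq> y" using * ne by auto
        have "pairwise orthogonal {x, y}"
          using * xy by (auto simp: pairwise_def orthogonal_def inner_commute)
        then have "independent {x, y}"
          using ne pairwise_orthogonal_independent by blast
        then have "card {x, y} \<le> dim (eigenspace M \<mu>)"
          using * True by (intro independent_card_le_dim) (auto simp: eigenspace_def)
        ultimately show False using xy by simp
      qed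
    qed
  next
    assume R: ?R
    have dim1: "dim (eigenspace M \<mu>) \<le> 1" if mu: "\<mu> < 0" for \<mu>
    proof (rule ccontr)
      assume "\<not> dim (eigenspace M \<mu>) \<le> 1"
      then have d: "dim (eigenspace M \<mu>) > 1" by simp
      then have "\<not> eigenspace M \<mu> \<subseteq> {0}" using dim_eq_0[of "eigenspace M \<mu>"] by linarith
      then obtain x where x: "x \<in> eigenspace M \<mu>" "x \<noteq> 0" by blast
      have "span {x} \<subseteq> span (eigenspace M \<mu>)" using x by (intro span_mono) simp
      moreover have "span {x} \<noteq> span (eigenspace M \<mu>)"
      proof
        assume "span {x} = span (eigenspace M \<mu>)"
        then have "dim {x} = dim (eigenspace M \<mu>)" by (metis dim_span)
        then show False using d x by (simp add: dim_singleton)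
      qed
      ultimately obtain y where "y \<noteq> 0" "y \<in> span (eigenspace M \<mu>)"
          and "\<And>z. z \<in> span {x} \<Longrightarrow> orthogonal y z"
        using orthogonal_to_subspace_exists_gen[of "{x}" "eigenspace M \<mu>"] by blast
      then have "y \<noteq> 0" "y \<in> eigenspace M \<mu>" "x \<bullet> y = 0"
        using sub[of \<mu>] by (auto simp: span_base orthogonal_def inner_commute span_eq_iff[THEN iffD2])
      with R x mu show False by (auto simp: eigenspace_def)
    qed
    have "card (neg_eigenvalues M) \<le> 1"
      unfolding One_nat_def card_le_Suc0_iff_eq[OF fin]
    proof (intro ballI)
      fix \<mu> \<nu> assume "\<mu> \<in> neg_eigenvalues M" "\<nu> \<in> neg_eigenvalues M"
      then obtain x y where *: "\<mu> < 0" "\<nu> < 0" "x \<noteq> 0" "y \<noteq> 0"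
          "M *v x = \<mu> *\<^sub>R x" "M *v y = \<nu> *\<^sub>R y"
        by (auto simp: neg_eigenvalues_def)
      have "\<nu> * (x \<bullet> y) = \<mu> * (x \<bullet> y)"
        using symmetric_inner[OF sym, of x y] * by (simp add: inner_commute)
      moreover have "x \<bullet> y \<noteq> 0" using R * by blast
      ultimately show "\<mu> = \<nu>" by simp
    qed
    moreover have "num_neg_eigenvalues M \<le> (\<Sum>\<mu>\<in>neg_eigenvalues M. 1)"
      unfolding num_neg_eigenvalues_def
      by (intro sum_mono dim1) (simp add: neg_eigenvalues_def)
    ultimately show "num_neg_eigenvalues M \<le> 1" by simp
  qed
qed

text \<open>
  Two orthogonal negative eigenvectors span a plane on which the form is negative definite, and every
  plane meets the hyperplane nontrivially.
\<close>

lemma psd_on_hyperplane_imp_num_neg_eigenvalues_le_1: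
  fixes M :: "real^'k^'k"
  assumes sym: "transpose M = M" and psd: "psd_on_hyperplane M h"
  shows "num_neg_eigenvalues M \<le> 1"
  unfolding num_neg_eigenvalues_le_1_iff[OF sym]
proof (intro allI impI, elim conjE, rule ccontr)
  fix x y \<mu> \<nu>
  assume *: "\<mu> < 0" "\<nu> < 0" "M *v x = \<mu> *\<^sub>R x" "M *v y = \<nu> *\<^sub>R y" "x \<bullet> y = 0"
    and "\<not> (x = 0 \<or> y = 0)"
  then have pos: "x \<bullet> x > 0" "y \<bullet> y > 0" by auto
  have "h \<bullet> ((h \<bullet> y) *\<^sub>R x + (- (h \<bullet> x)) *\<^sub>R y) = 0"
    by (simp add: inner_diff_right)
  then have "0 \<le> (h \<bullet> y)\<^sup>2 * (\<mu> * (x \<bullet> x)) + (h \<bullet> x)\<^sup>2 * (\<nu> * (y \<bullet> y))"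
    using psd[unfolded psd_on_hyperplane_def, rule_format,
        of "(h \<bullet> y) *\<^sub>R x + (- (h \<bullet> x)) *\<^sub>R y"] *
    unfolding quadratic_form_lincomb[OF sym] by simp
  moreover have mu: "\<mu> * (x \<bullet> x) < 0" "\<nu> * (y \<bullet> y) < 0"
    using * pos by (simp_all add: mult_neg_pos)
  ultimately have "h \<bullet> x = 0"
    by (smt (verit) mult_nonneg_nonpos mult_pos_neg zero_le_power2 zero_less_power2)
  then have "0 \<le> x \<bullet> (M *v x)" using psd by (simp add: psd_on_hyperplane_def)
  then show False using * mu by simp
qed

text \<open>
  The orthogonal complement of a negative eigenvector is invariant; a negative value of the form there
  would produce a second negative eigenvector orthogonal to the first.
\<close>

lemma num_neg_eigenvalues_le_1_imp_psd_on_hyperplane: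
  fixes M :: "real^'k^'k"
  assumes sym: "transpose M = M" and num: "num_neg_eigenvalues M \<le> 1"
  obtains h where "psd_on_hyperplane M h"
proof (cases "\<exists>x0. x0 \<bullet> (M *v x0) < 0")
  case False
  then show ?thesis using that[of 0] by (auto simp: psd_on_hyperplane_def not_less)
next
  case True
  then obtain x0 where x0: "x0 \<bullet> (M *v x0) < 0" ..
  obtain v \<mu> where v: "v \<noteq> 0" "\<mu> < 0" "M *v v = \<mu> *\<^sub>R v"
    using negative_eigenvector_in_invariant_subspace[OF sym subspace_UNIV _ _ x0] by blast
  have "psd_on_hyperplane M v"
    unfolding psd_on_hyperplane_def
  proof (intro allI impI, rule ccontr)
    fix z assume z: "v \<bullet> z = 0" "\<not> 0 \<le> z \<bullet> (M *v z)"
    have "M *v w \<in> {w. v \<bullet> w = 0}" if "w \<in> {w. v \<bullet> w = 0}" for w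
      using that v symmetric_inner[OF sym, of v w] by (simp add: inner_commute)
    then obtain w \<nu> where "w \<in> {w. v \<bullet> w = 0}" "w \<noteq> 0" "\<nu> < 0" "M *v w = \<nu> *\<^sub>R w"
      using negative_eigenvector_in_invariant_subspace[OF sym subspace_hyperplane[of v], of z] z
      by force
    with v num show False unfolding num_neg_eigenvalues_le_1_iff[OF sym] by blast
  qed
  then show ?thesis by (rule that)
qed

section \<open>Homogenization\<close>

definition homog :: "real^'n \<Rightarrow> real^('n::finite option)" where
  "homog x = (\<chi> i. case i of Some k \<Rightarrow> x $ k | None \<Rightarrow> 1)"

lemma sum_UNIV_option:
  fixes g :: "'n::finite option \<Rightarrow> 'a::comm_monoid_add"
  shows "(\<Sum>i\<in>UNIV. g i) = g None + (\<Sum>k\<in>UNIV. g (Some k))"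
  by (simp add: UNIV_option_conv sum.insert sum.reindex)

lemma inner_homog: "h \<bullet> homog x = (\<chi> k. h $ Some k) \<bullet> x + h $ None"
  by (simp add: inner_vec_def homog_def sum_UNIV_option)

lemma homog_nonzero: "homog x \<noteq> 0"
  by (auto simp: homog_def vec_eq_iff split: option.split intro!: exI[of _ None])

lemma homog_affine:
  assumes "a + b = 1"
  shows "homog (a *\<^sub>R x + b *\<^sub>R y) = a *\<^sub>R homog x + b *\<^sub>R homog y"
  using assms by (auto simp: homog_def vec_eq_iff split: option.split)

lemma homog_decompose:
  assumes "z $ None \<noteq> 0"
  shows "z = (z $ None) *\<^sub>R homog (\<chi> k. z $ Some k / z $ None)"
  using assms by (auto simp: homog_def vec_eq_iff split: option.split)

lemma symmetric_entries:
  fixes M :: "'a^'k^'k"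
  assumes "transpose M = M"
  shows "M $ i $ j = M $ j $ i"
  using assms by (metis transpose_def vec_lambda_beta)

lemma transpose_hom_mat:
  assumes "transpose A = A"
  shows "transpose (hom_mat A b c) = hom_mat A b c"
proof -
  have "A $ i $ j = A $ j $ i" for i j
    using assms by (metis transpose_def vec_lambda_beta)
  then show ?thesis
    by (auto simp: hom_mat_def transpose_def vec_eq_iff split: option.split)
qed

lemma quad_fun_eq_homog:
  "quad_fun A b c x = homog x \<bullet> (hom_mat A b c *v homog x)"
  by (simp add: quad_fun_def inner_vec_def matrix_vector_mult_def homog_def hom_mat_def
      sum_UNIV_option sum.distrib algebra_simps sum_distrib_left)

lemma agg_mat_form:
  fixes A :: "'m::finite \<Rightarrow> real^'n^'n"
  shows
  "z \<bullet> (agg_mat A b c l *v w) = (\<Sum>i\<in>UNIV. l $ i * (z \<bullet> (hom_mat (A i) (b i) (c i) *v w)))"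
proof -
  have "(sum f I) *v w = (\<Sum>i\<in>I. f i *v w)" for f :: "'m \<Rightarrow> real^('n option)^('n option)" and I
    by (induction I rule: infinite_finite_induct)
      (auto simp: matrix_vector_mult_add_rdistrib)
  then show ?thesis
    by (simp add: agg_mat_def inner_sum_right scaleR_matrix_vector_assoc[symmetric])
qed

lemma agg_set_eq_homog:
  "agg_set A b c l = {x. homog x \<bullet> (agg_mat A b c l *v homog x) < 0}"
  by (simp add: agg_set_def agg_mat_form quad_fun_eq_homog)

lemma transpose_agg_mat:
  assumes "\<And>i. transpose (A i) = A i"
  shows "transpose (agg_mat A b c l) = agg_mat A b c l"
proof -
  have "hom_mat (A i) (b i) (c i) $ j $ k = hom_mat (A i) (b i) (c i) $ k $ j" for i j k
    by (intro symmetric_entries transpose_hom_mat assms)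
  then show ?thesis
    by (simp add: agg_mat_def transpose_def vec_eq_iff)
qed

lemma continuous_quad_fun: "continuous_on UNIV (quad_fun A b c)"
  unfolding quad_fun_def
  by (intro continuous_intros)

lemma open_sol_set: "open (sol_set A b c)"
proof -
  have "sol_set A b c = (\<Inter>i. {x. quad_fun (A i) (b i) (c i) x < 0})"
    by (auto simp: sol_set_def)
  moreover have "open {x. quad_fun (A i) (b i) (c i) x < 0}" for i
    by (intro open_Collect_less continuous_quad_fun continuous_intros)
  ultimately show ?thesis by (simp add: open_INT)
qed

lemma sol_set_subset_agg_set:
  fixes A :: "'m::finite \<Rightarrow> real^'n^'n"
  assumes l: "\<And>i. 0 \<le> l $ i" "l \<noteq> 0"
  shows "sol_set A b c \<subseteq> agg_set A b c l"
proof
  fix x assume x: "x \<in> sol_set A b c"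
  obtain j where "l $ j \<noteq> 0" using l(2) by (auto simp: vec_eq_iff)
  then have j: "l $ j > 0" using l(1)[of j] by simp
  have "(\<Sum>i\<in>UNIV. l $ i * quad_fun (A i) (b i) (c i) x) < (\<Sum>i\<in>(UNIV :: 'm set). 0)"
  proof (rule sum_strict_mono_ex1)
    show "\<forall>i\<in>UNIV. l $ i * quad_fun (A i) (b i) (c i) x \<le> 0"
      using x l(1) by (simp add: sol_set_def mult_nonneg_nonpos less_imp_le)
    show "\<exists>i\<in>UNIV. l $ i * quad_fun (A i) (b i) (c i) x < 0"
      using x j by (intro bexI[of _ j]) (simp_all add: sol_set_def mult_pos_neg)
  qed simp
  then show "x \<in> agg_set A b c l" by (simp add: agg_set_def)
qed


lemma agg_mat_lincomb:
  "agg_mat A b c (s *\<^sub>R l + t *\<^sub>R l') = s *\<^sub>R agg_mat A b c l + t *\<^sub>R agg_mat A b c l'"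
  by (simp add: agg_mat_def scaleR_add_left sum.distrib scaleR_sum_right)

lemma agg_mat_axis: "agg_mat A b c (axis u 1) = hom_mat (A u) (b u) (c u)"
proof -
  have "agg_mat A b c (axis u 1)
      = (\<Sum>i\<in>UNIV. if i = u then hom_mat (A i) (b i) (c i) else 0)"
    unfolding agg_mat_def by (intro sum.cong) (auto simp: axis_def)
  then show ?thesis by simp
qed

lemma lincomb_form:
  fixes M N :: "real^'k^'k"
  shows "w \<bullet> ((s *\<^sub>R M + t *\<^sub>R N) *v w) = s * (w \<bullet> (M *v w)) + t * (w \<bullet> (N *v w))"
  by (simp add: matrix_vector_mult_add_rdistrib scaleR_matrix_vector_assoc[symmetric] inner_add_right)

section \<open>Certificates for membership in Omega\<close>

text \<open>
  A nonconstant affine function has no local minimum. The case of \<open>h\<close> with only the last coordinate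
  different from zero is included: the affine function is then a nonzero constant.
\<close>

lemma affine_pos_on_open:
  assumes "open S" and h: "h \<noteq> 0" and nonneg: "\<And>x. x \<in> S \<Longrightarrow> 0 \<le> h \<bullet> homog x"
    and x: "x \<in> S"
  shows "0 < h \<bullet> homog x"
proof (rule ccontr)
  define g where "g = (\<chi> k. h $ Some k)"
  assume "\<not> 0 < h \<bullet> homog x"
  with nonneg[OF x] have zero: "g \<bullet> x + h $ None = 0"
    by (simp add: inner_homog g_def)
  have g: "g \<noteq> 0"
  proof
    assume g0: "g = 0"
    then have "h $ i = 0" for i
      using zero g0 by (cases i) (simp_all add: g_def vec_eq_iff, simp add: inner_vec_def)
    then show False using h by (simp add: vec_eq_iff)
  qed
  obtain e where e: "e > 0" "ball x e \<subseteq> S"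
    using \<open>open S\<close> x openE by blast
  define t where "t = e / (2 * norm g)"
  have t: "t > 0" using e g by (simp add: t_def)
  have "x - t *\<^sub>R g \<in> ball x e"
    using e g by (simp add: dist_norm t_def)
  then have "0 \<le> h \<bullet> homog (x - t *\<^sub>R g)" using e nonneg by blast
  also have "\<dots> = - (t * (g \<bullet> g))"
    using zero by (simp add: inner_homog g_def[symmetric] inner_diff_right)
  also have "\<dots> < 0" using t g by simp
  finally show False by simp
qed

text \<open>
  The certificate places \<open>S\<close> in one of the two convex pieces of the negative cone of the aggregated
  form, so that the convex hull cannot leave it.
\<close>

lemma hull_subset_agg_set:
  assumes sym: "\<And>i. transpose (A i) = A i"
    and l: "\<And>i. 0 \<le> l $ i" "l \<noteq> 0"
    and pos: "\<And>x. x \<in> sol_set A b c \<Longrightarrow> 0 < h \<bullet> homog x"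
    and psd: "psd_on_hyperplane (agg_mat A b c l) h"
  shows "convex hull (sol_set A b c) \<subseteq> agg_set A b c l"
proof -
  let ?M = "agg_mat A b c l"
  let ?T = "{x. h \<bullet> homog x > 0 \<and> homog x \<bullet> (?M *v homog x) < 0}"
  have "convex ?T"
  proof (rule convexI)
    fix x y :: "real^'b" and s t :: real
    assume "x \<in> ?T" "y \<in> ?T" "0 \<le> s" "0 \<le> t" "s + t = 1"
    then show "s *\<^sub>R x + t *\<^sub>R y \<in> ?T"
      using convexD[OF convex_negative_half_cone[OF transpose_agg_mat[OF sym] psd],
          of "homog x" "homog y" s t] by (simp add: homog_affine)
  qed
  moreover have "sol_set A b c \<subseteq> ?T"
    using sol_set_subset_agg_set[OF l, where A = A and b = b and c = c] pos
    by (auto simp: agg_set_eq_homog)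
  ultimately have "convex hull (sol_set A b c) \<subseteq> ?T" by (rule hull_minimal[rotated])
  then show ?thesis by (auto simp: agg_set_eq_homog)
qed

text \<open>
  For the implication from left to right, \<open>conv S\<close> avoids the hyperplane on which \<open>Q\<^sub>\<lambda>\<close> is
  semidefinite; being convex, it lies on one side, and the sign of \<open>h\<close> can be chosen accordingly.
\<close>

lemma Omega_iff:
  assumes sym: "\<And>i. transpose (A i) = A i" and nonempty: "sol_set A b c \<noteq> {}"
  shows "l \<in> Omega A b c \<longleftrightarrow> (\<forall>i. 0 \<le> l $ i) \<and> l \<noteq> 0 \<and>
    (\<exists>h. (\<forall>x\<in>sol_set A b c. 0 < h \<bullet> homog x) \<and> psd_on_hyperplane (agg_mat A b c l) h)"
    (is "_ \<longleftrightarrow> ?R")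
proof
  assume R: ?R
  then obtain h where "\<And>x. x \<in> sol_set A b c \<Longrightarrow> 0 < h \<bullet> homog x"
      "psd_on_hyperplane (agg_mat A b c l) h" by blast
  with R show "l \<in> Omega A b c"
    using hull_subset_agg_set[OF sym, where l = l and b = b and c = c and h = h]
      psd_on_hyperplane_imp_num_neg_eigenvalues_le_1[OF transpose_agg_mat[OF sym]]
    by (simp add: Omega_def)
next
  let ?C = "convex hull (sol_set A b c)"
  assume "l \<in> Omega A b c"
  then have l: "\<forall>i. 0 \<le> l $ i" "l \<noteq> 0" and sub: "?C \<subseteq> agg_set A b c l"
    and num: "num_neg_eigenvalues (agg_mat A b c l) \<le> 1"
    by (auto simp: Omega_def)
  obtain h0 where h0: "psd_on_hyperplane (agg_mat A b c l) h0"
    using num_neg_eigenvalues_le_1_imp_psd_on_hyperplane[OF transpose_agg_mat[OF sym] num] .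
  have avoid: "h0 \<bullet> homog x \<noteq> 0" if "x \<in> ?C" for x
    using that sub h0 unfolding psd_on_hyperplane_def agg_set_eq_homog by force
  obtain x0 where x0: "x0 \<in> sol_set A b c" using nonempty by blast
  then have x0C: "x0 \<in> ?C" by (simp add: hull_inc)
  define h where "h = sgn (h0 \<bullet> homog x0) *\<^sub>R h0"
  have hx0: "0 < h \<bullet> homog x0"
    using avoid[OF x0C] by (simp add: h_def sgn_if)
  have zero_iff: "h \<bullet> z = 0 \<longleftrightarrow> h0 \<bullet> z = 0" for z
    using avoid[OF x0C] by (simp add: h_def sgn_if)
  have "0 < h \<bullet> homog x" if x: "x \<in> ?C" for x
  proof (rule ccontr)
    assume n: "\<not> 0 < h \<bullet> homog x"
    \<comment> \<open>The weights make the functional vanish on the segment from \<open>x0\<close> to \<open>x\<close>.\<close>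
    define p q where "p = h \<bullet> homog x0" and "q = - (h \<bullet> homog x)"
    have pq: "p > 0" "q \<ge> 0" using hx0 n by (simp_all add: p_def q_def)
    have one: "q / (p + q) + p / (p + q) = 1"
      using pq by (simp add: add_divide_distrib[symmetric])
    have "(q / (p + q)) *\<^sub>R x0 + (p / (p + q)) *\<^sub>R x \<in> ?C"
      using pq one by (intro convexD[OF convex_convex_hull] x0C x) auto
    moreover have "h \<bullet> homog ((q / (p + q)) *\<^sub>R x0 + (p / (p + q)) *\<^sub>R x) = 0"
      unfolding homog_affine[OF one] by (simp add: inner_add_right p_def[symmetric])
        (simp add: q_def)
    ultimately show False using avoid zero_iff by blast
  qed
  then have "\<forall>x\<in>sol_set A b c. 0 < h \<bullet> homog x" by (simp add: hull_inc)
  moreover have "psd_on_hyperplane (agg_mat A b c l) h"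
    using h0 by (simp add: psd_on_hyperplane_def zero_iff)
  ultimately show ?R using l by blast
qed

section \<open>Separating a point from the convex hull\<close>

text \<open>
  Convexity of the image of the hyperplane turns the absence of a common negative point of the forms
  into a single nonnegative combination of them that is semidefinite on that hyperplane.
\<close>

lemma exists_separating_aggregation:
  fixes A :: "'m::finite \<Rightarrow> real^'n^'n"
  assumes nonempty: "sol_set A b c \<noteq> {}"
    and hhc: "hidden_hyperplane_convex (hom_quad_map A b c)"
    and y: "y \<notin> convex hull (sol_set A b c)"
  obtains h l where "\<And>x. x \<in> sol_set A b c \<Longrightarrow> 0 < h \<bullet> homog x" "h \<bullet> homog y = 0"
    "\<And>i. 0 \<le> l $ i" "l \<noteq> 0" "psd_on_hyperplane (agg_mat A b c l) h"
proof -
  let ?S = "sol_set A b c" and ?F = "hom_quad_map A b c"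
  have "\<exists>a \<beta>. a \<noteq> 0 \<and> (\<forall>x\<in>convex hull ?S. a \<bullet> x \<le> \<beta>) \<and> (\<forall>x\<in>{y}. a \<bullet> x \<ge> \<beta>)"
    using nonempty y by (intro separating_hyperplane_sets) auto
  then obtain a \<beta> where a: "a \<noteq> 0" "\<And>x. x \<in> convex hull ?S \<Longrightarrow> a \<bullet> x \<le> \<beta>" "a \<bullet> y \<ge> \<beta>"
    by blast
  define h :: "real^('n option)"
    where "h = (\<chi> i. case i of Some k \<Rightarrow> - a $ k | None \<Rightarrow> a \<bullet> y)"
  have hx: "h \<bullet> homog x = a \<bullet> y - a \<bullet> x" for x
    by (simp add: inner_homog h_def) (simp add: inner_vec_def sum_negf)
  have h: "h \<noteq> 0"
  proof
    assume "h = 0"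
    then have "h $ Some k = 0" for k by simp
    then show False using a(1) by (simp add: h_def vec_eq_iff)
  qed
  have hy: "h \<bullet> homog y = 0" by (simp add: hx)
  have pos: "0 < h \<bullet> homog x" if "x \<in> ?S" for x
  proof (rule affine_pos_on_open[OF open_sol_set h _ that])
    fix x assume "x \<in> ?S"
    then have "a \<bullet> x \<le> \<beta>" using a(2) by (simp add: hull_inc)
    then show "0 \<le> h \<bullet> homog x" using a(3) by (simp add: hx)
  qed
  let ?H = "{z. h \<bullet> z = 0}"
  let ?N = "{v::real^'m. \<forall>i. v $ i < 0}"
  have "dim ?H + 1 = CARD('n option)"
    using dim_hyperplane[OF h] by (simp add: card_UNIV_option)
  then have "convex (?F ` ?H)"
    using hhc subspace_hyperplane unfolding hidden_hyperplane_convex_def by blast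
  moreover have "convex ?N"
  proof -
    have "?N = (\<Inter>i. {v. axis i 1 \<bullet> v < 0})" by (auto simp: inner_axis')
    then show ?thesis by (simp add: convex_INT convex_halfspace_lt)
  qed
  moreover have "?F ` ?H \<inter> ?N = {}"
  proof -
    \<comment> \<open>A point with nonzero last coordinate is a multiple of some \<open>homog x\<close>, where \<open>x\<close> would lie in \<open>S\<close>.\<close>
    have finite_pt: False if z: "h \<bullet> z = 0" "z $ None \<noteq> 0" "?F z \<in> ?N" for z
    proof -
      define x where "x = (\<chi> k. z $ Some k / z $ None)"
      have zx: "z = (z $ None) *\<^sub>R homog x" unfolding x_def by (rule homog_decompose[OF z(2)])
      have "quad_fun (A i) (b i) (c i) x < 0" for i
      proof -
        have "z \<bullet> (hom_mat (A i) (b i) (c i) *v z) = (z $ None)\<^sup>2 * quad_fun (A i) (b i) (c i) x"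
          by (subst (1 2) zx) (simp add: quad_fun_eq_homog matrix_vector_mult_scaleR power2_eq_square)
        then show ?thesis
          using z(2,3) by (simp add: hom_quad_map_def)
            (metis mult_less_cancel_left_pos mult_zero_right zero_less_power2)
      qed
      then have "0 < h \<bullet> homog x" by (intro pos) (simp add: sol_set_def)
      moreover have "(z $ None) * (h \<bullet> homog x) = 0"
        using z(1) by (subst (asm) zx) simp
      ultimately show False using z(2) by simp
    qed
    have False if z: "h \<bullet> z = 0" "?F z \<in> ?N" for z
    proof (cases "z $ None = 0")
      case False
      then show ?thesis using finite_pt z by blast
    next
      case True
      \<comment> \<open>A point at infinity is moved within the hyperplane towards \<open>homog y\<close>, keeping all forms negative.\<close>
      let ?p = "\<lambda>e. z + e *\<^sub>R homog y"
      have "\<forall>\<^sub>F e in at_right 0. \<forall>i\<in>UNIV. ?F (?p e) $ i < 0"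
      proof (intro eventually_ball_finite ballI)
        fix i
        have "((\<lambda>e. ?F (?p e) $ i) \<longlongrightarrow> ?F (?p 0) $ i) (at_right 0)"
          unfolding hom_quad_map_def vec_lambda_beta matrix_vector_right_distrib matrix_vector_mult_scaleR
          by (intro tendsto_intros)
        moreover have "?F (?p 0) $ i < 0" using z by simp
        ultimately show "\<forall>\<^sub>F e in at_right 0. ?F (?p e) $ i < 0" by (rule order_tendstoD)
      qed simp
      then have "\<forall>\<^sub>F e in at_right 0. 0 < e \<and> (\<forall>i\<in>UNIV. ?F (?p e) $ i < 0)"
        by (intro eventually_conj eventually_at_right_less)
      then obtain e where e: "0 < e" "\<And>i. ?F (?p e) $ i < 0"
        using eventually_happens'[OF trivial_limit_at_right_real] by blast
      have "h \<bullet> ?p e = 0" using z hy by (simp add: inner_add_right)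
      moreover have "?p e $ None \<noteq> 0" using True e by (simp add: homog_def)
      ultimately show False using finite_pt e by blast
    qed
    then show ?thesis by blast
  qed
  moreover have F0: "0 \<in> ?F ` ?H"
    by (rule image_eqI[of _ _ 0]) (simp_all add: hom_quad_map_def vec_eq_iff)
  moreover have N1: "(\<chi> i. -1) \<in> ?N" by simp
  ultimately have "\<exists>l \<gamma>. l \<noteq> 0 \<and> (\<forall>v\<in>?N. l \<bullet> v \<le> \<gamma>) \<and> (\<forall>v\<in>?F ` ?H. l \<bullet> v \<ge> \<gamma>)"
    by (intro separating_hyperplane_sets) blast+
  then obtain l \<gamma> where l: "l \<noteq> 0" "\<And>v. v \<in> ?N \<Longrightarrow> l \<bullet> v \<le> \<gamma>"
      "\<And>v. v \<in> ?F ` ?H \<Longrightarrow> \<gamma> \<le> l \<bullet> v" by blast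
  \<comment> \<open>Both sets are cones with apex 0, so the separating constant is 0 and the normal is nonnegative.\<close>
  have gamma: "\<gamma> \<le> 0" using l(3)[OF F0] by simp
  have cone: "l \<bullet> v \<le> 0" if v: "\<And>i. v $ i \<le> 0" for v
  proof (rule ccontr)
    assume c: "\<not> l \<bullet> v \<le> 0"
    \<comment> \<open>Large enough for \<open>s * (l \<bullet> v)\<close> to outweigh the shift by \<open>-1\<close> into the open orthant.\<close>
    define s where "s = \<bar>\<Sum>i\<in>UNIV. l $ i\<bar> / (l \<bullet> v) + 1"
    have "s *\<^sub>R v + (\<chi> i. -1) \<in> ?N"
    proof -
      have "s \<ge> 0" using c by (simp add: s_def)
      then have "s * v $ i \<le> 0" for i using v by (simp add: mult_nonneg_nonpos)
      then show ?thesis by (simp add: add_nonpos_neg less_imp_le) (smt (verit))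
    qed
    then have "s * (l \<bullet> v) + l \<bullet> (\<chi> i. -1) \<le> 0"
      using l(2) gamma by (fastforce simp: inner_add_right)
    moreover have "s * (l \<bullet> v) = \<bar>\<Sum>i\<in>UNIV. l $ i\<bar> + l \<bullet> v"
      using c by (simp add: s_def field_simps)
    moreover have "l \<bullet> (\<chi> i. -1) = - (\<Sum>i\<in>UNIV. l $ i)"
      by (simp add: inner_vec_def sum_negf)
    ultimately show False using c by linarith
  qed
  have lnn: "0 \<le> l $ i" for i
    using cone[of "- axis i 1"] by (simp add: inner_axis) (simp add: axis_def)
  have gamma0: "0 \<le> \<gamma>"
  proof (rule ccontr)
    assume c: "\<not> 0 \<le> \<gamma>"
    \<comment> \<open>Small enough for the value of \<open>l\<close> at a point \<open>(-s, \<dots>, -s)\<close> near 0 to exceed \<open>\<gamma>\<close>.\<close>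
    define s where "s = - \<gamma> / (2 * (\<bar>\<Sum>i\<in>UNIV. l $ i\<bar> + 1))"
    have s: "s > 0" using c by (simp add: s_def divide_neg_pos)
    have "s *\<^sub>R (\<chi> i. -1) \<in> ?N" using s by simp
    from l(2)[OF this] have "- (s * (\<Sum>i\<in>UNIV. l $ i)) \<le> \<gamma>"
      by (simp add: inner_vec_def sum_negf sum_distrib_left mult.commute)
    moreover have "s * (\<Sum>i\<in>UNIV. l $ i) \<le> s * (\<bar>\<Sum>i\<in>UNIV. l $ i\<bar> + 1)"
      using s by (intro mult_left_mono) auto
    moreover have "s * (\<bar>\<Sum>i\<in>UNIV. l $ i\<bar> + 1) = - \<gamma> / 2"
      by (simp add: s_def field_simps)
    ultimately show False using c by linarith
  qed
  have "psd_on_hyperplane (agg_mat A b c l) h"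
    unfolding psd_on_hyperplane_def
  proof (intro allI impI)
    fix z assume "h \<bullet> z = 0"
    then have "\<gamma> \<le> l \<bullet> ?F z" using l(3) by blast
    also have "l \<bullet> ?F z = z \<bullet> (agg_mat A b c l *v z)"
      unfolding agg_mat_form inner_vec_def[of l]
      by (simp only: hom_quad_map_def vec_lambda_beta inner_real_def)
    finally show "0 \<le> z \<bullet> (agg_mat A b c l *v z)" using gamma0 by simp
  qed
  with that pos hy lnn l(1) show ?thesis by blast
qed

section \<open>Reducing the support\<close>

text \<open>
  The vector \<open>w\<close> in the hyperplane guarantees that the reduction does not end at zero: the reduced
  aggregation is positive at \<open>w\<close> because a definite form has been added to a semidefinite one.
\<close>

lemma reduce_support:
  fixes A :: "'m::finite \<Rightarrow> real^'n^'n"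
  assumes nonempty: "sol_set A b c \<noteq> {}"
    and pd: "\<And>i j k. i \<noteq> j \<Longrightarrow> i \<noteq> k \<Longrightarrow> j \<noteq> k \<Longrightarrow>
      \<exists>p q r. pos_definite (p *\<^sub>R hom_mat (A i) (b i) (c i) + q *\<^sub>R hom_mat (A j) (b j) (c j)
                + r *\<^sub>R hom_mat (A k) (b k) (c k))"
    and w: "w \<noteq> 0" "h \<bullet> w = 0"
    and l: "\<And>i. 0 \<le> l $ i" "l \<noteq> 0" "psd_on_hyperplane (agg_mat A b c l) h"
  obtains l' where "\<And>i. 0 \<le> l' $ i" "l' \<noteq> 0" "psd_on_hyperplane (agg_mat A b c l') h"
    "card (support l') \<le> 2"
proof -
  have step: "\<exists>l'. (\<forall>i. 0 \<le> l' $ i) \<and> l' \<noteq> 0 \<and> psd_on_hyperplane (agg_mat A b c l') h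
      \<and> card (support l') < card (support l)"
    if l: "\<And>i. 0 \<le> l $ i" "psd_on_hyperplane (agg_mat A b c l) h" "card (support l) > 2" for l
  proof -
    have "3 \<le> card (support l)" using l(3) by simp
    then obtain T where T: "T \<subseteq> support l" "card T = 3"
      using obtain_subset_with_card_n by metis
    then obtain i j k where ijk: "T = {i, j, k}" "i \<noteq> j" "i \<noteq> k" "j \<noteq> k"
      by (auto simp: card_3_iff)
    then obtain p q r where pqr: "pos_definite (p *\<^sub>R hom_mat (A i) (b i) (c i)
        + q *\<^sub>R hom_mat (A j) (b j) (c j) + r *\<^sub>R hom_mat (A k) (b k) (c k))"
      using pd by metis
    define d :: "real^'m" where "d = 1 *\<^sub>R (p *\<^sub>R axis i 1 + q *\<^sub>R axis j 1) + r *\<^sub>R axis k 1"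
    have dpos: "0 < z \<bullet> (agg_mat A b c d *v z)" if "z \<noteq> 0" for z
      using pqr that unfolding pos_definite_def d_def agg_mat_lincomb agg_mat_axis by simp
    have doff: "d $ s = 0" if "s \<notin> T" for s
      using that ijk by (auto simp: d_def axis_def)
    have lT: "0 < l $ s" if "s \<in> T" for s
      using that T by (auto simp: support_def)
    \<comment> \<open>A nonnegative combination of the forms is not positive at a point of \<open>S\<close>.\<close>
    have "\<exists>s. d $ s < 0"
    proof (rule ccontr)
      assume c: "\<not> (\<exists>s. d $ s < 0)"
      obtain x where "x \<in> sol_set A b c" using nonempty by blast
      then have "(\<Sum>s\<in>UNIV. d $ s * quad_fun (A s) (b s) (c s) x) \<le> 0"
        using c by (intro sum_nonpos) (auto simp: sol_set_def not_less mult_nonneg_nonpos less_imp_le)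
      then have "homog x \<bullet> (agg_mat A b c d *v homog x) \<le> 0"
        by (simp add: agg_mat_form quad_fun_eq_homog)
      then show False using dpos[OF homog_nonzero, of x] by linarith
    qed
    then have D: "{s. d $ s < 0} \<noteq> {}" by blast
    \<comment> \<open>Ratio test: the first coordinate of \<open>l + t d\<close> to vanish as \<open>t\<close> grows.\<close>
    let ?ratio = "\<lambda>s. l $ s / (- d $ s)"
    define s0 where "s0 = arg_min_on ?ratio {s. d $ s < 0}"
    have s0: "d $ s0 < 0"
      using arg_min_if_finite(1)[OF finite D, of ?ratio] by (simp add: s0_def)
    have s0_le: "?ratio s0 \<le> ?ratio s" if "d $ s < 0" for s
      using arg_min_least[OF finite D, of s ?ratio] that by (simp add: s0_def)
    define t where "t = ?ratio s0"
    have "s0 \<in> T" using s0 doff by force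
    then have t: "0 < t" using lT s0 by (simp add: t_def divide_pos_neg)
    define l' where "l' = 1 *\<^sub>R l + t *\<^sub>R d"
    have nn: "0 \<le> l' $ s" for s
    proof (cases "d $ s < 0")
      case True
      then have "t \<le> l $ s / (- d $ s)" using s0_le by (simp add: t_def)
      moreover have "0 < - d $ s" using True by simp
      ultimately have "t * (- d $ s) \<le> l $ s" by (simp only: pos_le_divide_eq)
      then show ?thesis by (simp add: l'_def)
    next
      case False
      then show ?thesis using t l(1)[of s] by (simp add: l'_def)
    qed
    have "l' $ s0 = 0" using s0 by (simp add: l'_def t_def)
    then have "s0 \<notin> support l'" by (simp add: support_def)
    moreover have "s0 \<in> support l" using \<open>s0 \<in> T\<close> T by blast
    moreover have "support l' \<subseteq> support l"
    proof
      fix s assume s: "s \<in> support l'"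
      show "s \<in> support l"
      proof (cases "s \<in> T")
        case False
        then show ?thesis using s doff by (simp add: support_def l'_def)
      qed (use T in blast)
    qed
    ultimately have "card (support l') < card (support l)"
      by (intro psubset_card_mono) auto
    moreover have form: "z \<bullet> (agg_mat A b c l' *v z)
        = z \<bullet> (agg_mat A b c l *v z) + t * (z \<bullet> (agg_mat A b c d *v z))" for z
      unfolding l'_def agg_mat_lincomb lincomb_form by simp
    have "0 < w \<bullet> (agg_mat A b c l' *v w)"
      unfolding form using l(2) w dpos[OF w(1)] t
      by (intro add_nonneg_pos) (auto simp: psd_on_hyperplane_def)
    then have "l' \<noteq> 0" by (auto simp: agg_mat_form)
    moreover have "psd_on_hyperplane (agg_mat A b c l') h"
      unfolding psd_on_hyperplane_def form
    proof (intro allI impI)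
      fix z assume "h \<bullet> z = 0"
      then show "0 \<le> z \<bullet> (agg_mat A b c l *v z) + t * (z \<bullet> (agg_mat A b c d *v z))"
        using l(2) dpos[of z] t by (cases "z = 0") (auto simp: psd_on_hyperplane_def)
    qed
    ultimately show ?thesis using nn by blast
  qed
  have "\<exists>l'. (\<forall>i. 0 \<le> l' $ i) \<and> l' \<noteq> 0 \<and> psd_on_hyperplane (agg_mat A b c l') h
      \<and> card (support l') \<le> 2"
    using l
  proof (induction "card (support l)" arbitrary: l rule: less_induct)
    case less
    show ?case
    proof (cases "card (support l) \<le> 2")
      case True
      then show ?thesis using less.prems by blast
    next
      case False
      then show ?thesis using step[of l] less.prems less.hyps by (meson not_le)
    qed
  qed
  with that show ?thesis by blast
qed

section \<open>Aggregations supported on a pair of indices\<close>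

definition segment_point :: "'m::finite \<Rightarrow> 'm \<Rightarrow> real \<Rightarrow> real^'m" where
  "segment_point u v \<alpha> = \<alpha> *\<^sub>R axis u 1 + (1 - \<alpha>) *\<^sub>R axis v 1"

lemma segment_point_swap: "segment_point v u (1 - \<alpha>) = segment_point u v \<alpha>"
  by (simp add: segment_point_def)

lemma segment_point_nth:
  assumes "u \<noteq> v"
  shows "segment_point u v \<alpha> $ i = (if i = u then \<alpha> else if i = v then 1 - \<alpha> else 0)"
  using assms by (auto simp: segment_point_def axis_def)

lemma support_segment_point: "u \<noteq> v \<Longrightarrow> support (segment_point u v \<alpha>) \<subseteq> {u, v}"
  by (auto simp: support_def segment_point_nth split: if_splits)

lemma agg_mat_segment_point:
  "agg_mat A b c (segment_point u v \<alpha>)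
     = \<alpha> *\<^sub>R hom_mat (A u) (b u) (c u) + (1 - \<alpha>) *\<^sub>R hom_mat (A v) (b v) (c v)"
  by (simp add: segment_point_def agg_mat_lincomb agg_mat_axis)

definition Omega_segment ::
  "('m::finite \<Rightarrow> real^'n^'n) \<Rightarrow> ('m \<Rightarrow> real^'n) \<Rightarrow> ('m \<Rightarrow> real) \<Rightarrow> 'm \<Rightarrow> 'm \<Rightarrow> real set" where
  "Omega_segment A b c u v = {\<alpha> \<in> {0..1}. segment_point u v \<alpha> \<in> Omega A b c}"

lemma Omega_segment_swap:
  "1 - \<alpha> \<in> Omega_segment A b c v u \<longleftrightarrow> \<alpha> \<in> Omega_segment A b c u v"
  by (auto simp: Omega_segment_def segment_point_swap)

lemma Omega_segment_iff:
  assumes sym: "\<And>i. transpose (A i) = A i" and nonempty: "sol_set A b c \<noteq> {}" and uv: "u \<noteq> v"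
  shows "\<alpha> \<in> Omega_segment A b c u v \<longleftrightarrow> \<alpha> \<in> {0..1} \<and>
    (\<exists>h. (\<forall>x\<in>sol_set A b c. 0 < h \<bullet> homog x)
       \<and> psd_on_hyperplane (agg_mat A b c (segment_point u v \<alpha>)) h)"
proof -
  have "segment_point u v \<alpha> \<noteq> 0"
  proof
    assume "segment_point u v \<alpha> = 0"
    then have "segment_point u v \<alpha> $ u = 0" "segment_point u v \<alpha> $ v = 0" by simp_all
    then show False using uv by (simp add: segment_point_nth)
  qed
  then show ?thesis
    by (auto simp: Omega_segment_def Omega_iff[OF sym nonempty] segment_point_nth[OF uv])
qed

text \<open>
  Composing the form with the orthogonal projection onto the hyperplane removes the implication from
  the definition; the resulting condition is visibly closed in \<open>M\<close> and \<open>h\<close> together.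
\<close>

lemma psd_on_hyperplane_unit_iff:
  fixes M :: "real^'k^'k"
  assumes "norm h = 1"
  shows "psd_on_hyperplane M h \<longleftrightarrow>
    (\<forall>z. 0 \<le> (z - (h \<bullet> z) *\<^sub>R h) \<bullet> (M *v (z - (h \<bullet> z) *\<^sub>R h)))"
proof
  assume M: "psd_on_hyperplane M h"
  have "h \<bullet> h = 1" using assms by (simp add: dot_square_norm)
  then have "h \<bullet> (z - (h \<bullet> z) *\<^sub>R h) = 0" for z by (simp add: inner_diff_right)
  then show "\<forall>z. 0 \<le> (z - (h \<bullet> z) *\<^sub>R h) \<bullet> (M *v (z - (h \<bullet> z) *\<^sub>R h))"
    using M by (simp add: psd_on_hyperplane_def)
next
  assume R: "\<forall>z. 0 \<le> (z - (h \<bullet> z) *\<^sub>R h) \<bullet> (M *v (z - (h \<bullet> z) *\<^sub>R h))"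
  show "psd_on_hyperplane M h"
    unfolding psd_on_hyperplane_def
  proof (intro allI impI)
    fix z assume "h \<bullet> z = 0"
    then show "0 \<le> z \<bullet> (M *v z)" using R[rule_format, of z] by simp
  qed
qed

text \<open>
  The segment is the projection of a compact set of pairs of a parameter and a unit certificate. The
  strict positivity on \<open>S\<close> is relaxed to a closed condition, which loses nothing because \<open>S\<close> is
  open (\<open>affine_pos_on_open\<close>).
\<close>

lemma compact_Omega_segment:
  fixes A :: "'m::finite \<Rightarrow> real^'n^'n"
  assumes sym: "\<And>i. transpose (A i) = A i" and nonempty: "sol_set A b c \<noteq> {}" and uv: "u \<noteq> v"
  shows "compact (Omega_segment A b c u v)"
proof -
  let ?S = "sol_set A b c"
  let ?Q = "\<lambda>i. hom_mat (A i) (b i) (c i)"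
  let ?w = "\<lambda>h z. z - (h \<bullet> z) *\<^sub>R h :: real^('n option)"
  define P1 where "P1 = {p :: real \<times> (real^('n option)). \<forall>x\<in>?S. 0 \<le> snd p \<bullet> homog x}"
  define P2 where "P2 = {p :: real \<times> (real^('n option)). \<forall>z.
    0 \<le> fst p * (?w (snd p) z \<bullet> (?Q u *v ?w (snd p) z))
        + (1 - fst p) * (?w (snd p) z \<bullet> (?Q v *v ?w (snd p) z))}"
  have mv: "continuous_on UNIV (\<lambda>p. M *v g p)" if "continuous_on UNIV g"
    for M :: "real^('n option)^('n option)" and g :: "real \<times> (real^('n option)) \<Rightarrow> real^('n option)"
    using continuous_on_compose2[OF matrix_vector_mult_linear_continuous_on[of UNIV M] that] by simp
  have "P1 = (\<Inter>x\<in>?S. {p. 0 \<le> snd p \<bullet> homog x})" by (auto simp: P1_def)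
  then have "closed P1"
    by (simp only:) (intro closed_INT ballI closed_Collect_le continuous_intros)
  moreover have "closed P2"
    unfolding P2_def by (intro closed_Collect_all closed_Collect_le continuous_intros mv)
  moreover have "compact ({0..1::real} \<times> sphere (0 :: real^('n option)) 1)"
    by (intro compact_Times) auto
  ultimately have "compact ({0..1} \<times> sphere 0 1 \<inter> (P1 \<inter> P2))"
    by (intro compact_Int_closed closed_Int)
  then have "compact (fst ` ({0..1} \<times> sphere 0 1 \<inter> (P1 \<inter> P2)))"
    by (intro compact_continuous_image continuous_intros)
  moreover have "Omega_segment A b c u v = fst ` ({0..1} \<times> sphere 0 1 \<inter> (P1 \<inter> P2))"
  proof -
    have P2_iff: "(\<alpha>, h) \<in> P2 \<longleftrightarrow> psd_on_hyperplane (agg_mat A b c (segment_point u v \<alpha>)) h"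
      if "norm h = 1" for \<alpha> h
      unfolding psd_on_hyperplane_unit_iff[OF that] agg_mat_segment_point lincomb_form P2_def
      by simp
    have "\<alpha> \<in> fst ` ({0..1} \<times> sphere 0 1 \<inter> (P1 \<inter> P2))" if al: "\<alpha> \<in> Omega_segment A b c u v" for \<alpha>
    proof -
      from al obtain h where h: "\<alpha> \<in> {0..1}" "\<forall>x\<in>?S. 0 < h \<bullet> homog x"
        "psd_on_hyperplane (agg_mat A b c (segment_point u v \<alpha>)) h"
        by (auto simp: Omega_segment_iff[OF sym nonempty uv])
      have "h \<noteq> 0" using h(2) nonempty by auto
      define g where "g = (1 / norm h) *\<^sub>R h"
      have g: "norm g = 1" using \<open>h \<noteq> 0\<close> by (simp add: g_def)
      have "psd_on_hyperplane (agg_mat A b c (segment_point u v \<alpha>)) g"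
        using h(3) \<open>h \<noteq> 0\<close> by (simp add: psd_on_hyperplane_def g_def)
      moreover have "\<forall>x\<in>?S. 0 \<le> g \<bullet> homog x"
        using h(2) by (simp add: g_def less_imp_le)
      ultimately have "(\<alpha>, g) \<in> {0..1} \<times> sphere 0 1 \<inter> (P1 \<inter> P2)"
        using h(1) g P2_iff[OF g] by (simp add: P1_def)
      then show ?thesis by force
    qed
    moreover have "\<alpha> \<in> Omega_segment A b c u v"
      if al: "\<alpha> \<in> fst ` ({0..1} \<times> sphere 0 1 \<inter> (P1 \<inter> P2))" for \<alpha>
    proof -
      from al obtain h where h: "\<alpha> \<in> {0..1}" "norm h = 1" "(\<alpha>, h) \<in> P1" "(\<alpha>, h) \<in> P2" by auto
      have "h \<noteq> 0" using h(2) by auto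
      then have "\<forall>x\<in>?S. 0 < h \<bullet> homog x"
        using h(3) by (auto simp: P1_def intro: affine_pos_on_open[OF open_sol_set[of A b c]])
      then show ?thesis
        using h P2_iff by (auto simp: Omega_segment_iff[OF sym nonempty uv])
    qed
    ultimately show ?thesis by blast
  qed
  ultimately show ?thesis by simp
qed

section \<open>Perturbing a nonsingular aggregation\<close>

text \<open>
  A hyperplane on which the form is semidefinite may touch its null cone. The hyperplane conjugate to
  a vector \<open>z\<close> with negative form value does not: a nonzero \<open>w\<close> with \<open>z\<^sup>T M w = 0\<close> and
  \<open>w\<^sup>T M w \<le> 0\<close> would have to lie in the kernel of \<open>M\<close>.
\<close>

lemma definite_on_conjugate_hyperplane:
  fixes M :: "real^'k^'k"
  assumes sym: "transpose M = M" and psd: "psd_on_hyperplane M h" and det: "det M \<noteq> 0"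
    and z: "h \<bullet> z > 0" "z \<bullet> (M *v z) < 0"
    and w: "w \<noteq> 0" "(M *v z) \<bullet> w = 0"
  shows "0 < w \<bullet> (M *v w)"
proof (rule ccontr)
  assume c: "\<not> 0 < w \<bullet> (M *v w)"
  have wz: "w \<bullet> (M *v z) = 0" "z \<bullet> (M *v w) = 0"
    using w(2) symmetric_inner[OF sym, of z w] by (simp_all add: inner_commute)
  define t where "t = h \<bullet> w / (h \<bullet> z)"
  have h0: "h \<bullet> (1 *\<^sub>R w + (- t) *\<^sub>R z) = 0"
    using z by (simp add: t_def inner_diff_right)
  then have "0 \<le> w \<bullet> (M *v w) + t\<^sup>2 * (z \<bullet> (M *v z))"
    using psd[unfolded psd_on_hyperplane_def, rule_format, OF h0]
    unfolding quadratic_form_lincomb[OF sym] by (simp add: wz)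
  then have "t = 0" "w \<bullet> (M *v w) = 0"
    using c z by (smt (verit) mult_pos_neg zero_less_power2 mult_nonneg_nonpos zero_le_power2)+
  then have hw: "h \<bullet> w = 0" using z by (simp add: t_def)
  have *: "v \<bullet> (M *v w) = 0" if "h \<bullet> v = 0" for v
    using semidefinite_form_null_vector[OF sym subspace_hyperplane[of h], of w v]
      psd hw that \<open>w \<bullet> (M *v w) = 0\<close> by (simp add: psd_on_hyperplane_def)
  have "v \<bullet> (M *v w) = 0" for v
  proof -
    have "h \<bullet> (v - (h \<bullet> v / (h \<bullet> z)) *\<^sub>R z) = 0"
      using z by (simp add: inner_diff_right)
    from *[OF this] show ?thesis by (simp add: inner_diff_left wz)
  qed
  then have "M *v w = 0" using inner_eq_zero_iff by blast
  then show False
    using det w(1) by (metis invertible_det_nz invertible_mult matrix_left_invertible_ker invertible_left_inverse)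
qed

text \<open>
  On the compact unit sphere of the hyperplane the definite form is bounded away from zero and the
  perturbation is bounded.
\<close>

lemma definite_on_hyperplane_perturb:
  fixes M N :: "real^'k^'k"
  assumes pd: "\<And>w. w \<noteq> 0 \<Longrightarrow> h \<bullet> w = 0 \<Longrightarrow> 0 < w \<bullet> (M *v w)"
  obtains e where "e > 0" "\<And>t. \<bar>t\<bar> \<le> e \<Longrightarrow> psd_on_hyperplane (1 *\<^sub>R M + t *\<^sub>R N) h"
proof -
  let ?K = "sphere 0 1 \<inter> {w. h \<bullet> w = 0}"
  have K: "compact ?K" by (simp add: compact_Int_closed closed_hyperplane)
  have unit: "(1 / norm z) *\<^sub>R z \<in> ?K" if "h \<bullet> z = 0" "z \<noteq> 0" for z
    using that by simp
  show ?thesis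
  proof (cases "?K = {}")
    case True
    then have "z = 0" if "h \<bullet> z = 0" for z using unit that by blast
    then have "psd_on_hyperplane (1 *\<^sub>R M + t *\<^sub>R N) h" for t
      by (metis psd_on_hyperplane_def inner_zero_left order_refl)
    then show ?thesis using that[of 1] by simp
  next
    case False
    have cont: "continuous_on ?K (\<lambda>z. z \<bullet> (B *v z))" for B :: "real^'k^'k"
      by (intro continuous_intros)
    obtain x where x: "x \<in> ?K" and xmin: "\<And>z. z \<in> ?K \<Longrightarrow> x \<bullet> (M *v x) \<le> z \<bullet> (M *v z)"
      using continuous_attains_inf[OF K False cont[of M]] by blast
    define \<mu> where "\<mu> = x \<bullet> (M *v x)"
    have mu: "\<mu> > 0" unfolding \<mu>_def using x by (intro pd) auto
    have "continuous_on ?K (\<lambda>z. \<bar>z \<bullet> (N *v z)\<bar>)" by (intro continuous_intros cont)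
    then obtain y where ymax: "\<And>z. z \<in> ?K \<Longrightarrow> \<bar>z \<bullet> (N *v z)\<bar> \<le> \<bar>y \<bullet> (N *v y)\<bar>"
      using continuous_attains_sup[OF K False] by blast
    define C where "C = \<bar>y \<bullet> (N *v y)\<bar> + 1"
    have C: "C > 0" by (simp add: C_def)
    have "psd_on_hyperplane (1 *\<^sub>R M + t *\<^sub>R N) h" if t: "\<bar>t\<bar> \<le> \<mu> / C" for t
      unfolding psd_on_hyperplane_def
    proof (intro allI impI)
      fix z assume hz: "h \<bullet> z = 0"
      show "0 \<le> z \<bullet> ((1 *\<^sub>R M + t *\<^sub>R N) *v z)"
      proof (cases "z = 0")
        case False
        define w where "w = (1 / norm z) *\<^sub>R z"
        have w: "w \<in> ?K" using unit[OF hz False] by (simp only: w_def)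
        have zw: "z = norm z *\<^sub>R w" using False by (simp add: w_def)
        have "\<bar>t * (w \<bullet> (N *v w))\<bar> \<le> \<mu> / C * C"
          unfolding abs_mult using t ymax[OF w] mu C by (intro mult_mono) (auto simp: C_def)
        then have "0 \<le> w \<bullet> (M *v w) + t * (w \<bullet> (N *v w))"
          using xmin[OF w] C by (simp add: \<mu>_def)
        then have "0 \<le> w \<bullet> ((1 *\<^sub>R M + t *\<^sub>R N) *v w)"
          unfolding lincomb_form by simp
        then show ?thesis
          by (subst (1 2) zw) (simp add: matrix_vector_mult_scaleR)
      qed simp
    qed
    then show ?thesis using that[of "\<mu> / C"] mu C by simp
  qed
qed

text \<open>
  The given certificate is replaced by \<open>g = - M x\<^sub>0'\<close> for a point \<open>x\<^sub>0\<close> of \<open>S\<close>. It is still positive on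
  \<open>S\<close> by \<open>reverse_Cauchy_Schwarz\<close>, and the form is definite on its hyperplane, so that \<open>g\<close> also
  certifies the neighbouring parameters.
\<close>

lemma Omega_segment_nonsingular_interior:
  fixes A :: "'m::finite \<Rightarrow> real^'n^'n"
  assumes sym: "\<And>i. transpose (A i) = A i" and nonempty: "sol_set A b c \<noteq> {}" and uv: "u \<noteq> v"
    and al: "\<alpha> \<in> Omega_segment A b c u v"
    and det: "det (\<alpha> *\<^sub>R hom_mat (A u) (b u) (c u) + (1 - \<alpha>) *\<^sub>R hom_mat (A v) (b v) (c v)) \<noteq> 0"
  obtains e where "e > 0"
    "\<And>t. \<bar>t\<bar> \<le> e \<Longrightarrow> \<alpha> + t \<in> {0..1} \<Longrightarrow> \<alpha> + t \<in> Omega_segment A b c u v"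
proof -
  let ?M = "agg_mat A b c (segment_point u v \<alpha>)"
  let ?N = "hom_mat (A u) (b u) (c u) - hom_mat (A v) (b v) (c v)"
  note symM = transpose_agg_mat[OF sym]
  from al obtain h where h: "\<forall>x\<in>sol_set A b c. 0 < h \<bullet> homog x" "psd_on_hyperplane ?M h"
    by (auto simp: Omega_segment_iff[OF sym nonempty uv])
  have neg: "homog x \<bullet> (?M *v homog x) < 0" if "x \<in> sol_set A b c" for x
    using al that hull_inc[of x "sol_set A b c" convex]
    by (auto simp: Omega_segment_def Omega_def agg_set_eq_homog)
  obtain x0 where x0: "x0 \<in> sol_set A b c" using nonempty by blast
  define g where "g = - (?M *v homog x0)"
  have "0 < g \<bullet> homog x" if "x \<in> sol_set A b c" for x
    using reverse_Cauchy_Schwarz[OF symM h(2), of "homog x" "homog x0"] h(1) neg that x0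
    by (simp add: g_def inner_commute)
  moreover have "0 < w \<bullet> (?M *v w)" if "w \<noteq> 0" "g \<bullet> w = 0" for w
    using definite_on_conjugate_hyperplane[OF symM h(2), of "homog x0" w] that h(1) neg[OF x0] x0 det
    by (simp add: g_def agg_mat_segment_point)
  then obtain e where e: "e > 0" "\<And>t. \<bar>t\<bar> \<le> e \<Longrightarrow> psd_on_hyperplane (1 *\<^sub>R ?M + t *\<^sub>R ?N) g"
    using definite_on_hyperplane_perturb[of g ?M ?N] by blast
  moreover have "1 *\<^sub>R ?M + t *\<^sub>R ?N = agg_mat A b c (segment_point u v (\<alpha> + t))" for t
    unfolding agg_mat_segment_point by (simp add: algebra_simps)
  ultimately show ?thesis
    using that[of e] by (auto simp: Omega_segment_iff[OF sym nonempty uv])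
qed

section \<open>Finitely many aggregations\<close>

text \<open>
  The greatest parameter for \<open>(u, v)\<close> is one minus the least one for \<open>(v, u)\<close>. The
  chosen aggregations are thus indexed by ordered pairs, which is where \<open>m\<^sup>2 - m\<close> comes from.
\<close>

definition least_parameter ::
  "('m::finite \<Rightarrow> real^'n^'n) \<Rightarrow> ('m \<Rightarrow> real^'n) \<Rightarrow> ('m \<Rightarrow> real) \<Rightarrow> 'm \<Rightarrow> 'm \<Rightarrow> real" where
  "least_parameter A b c u v = Inf (Omega_segment A b c u v)"

lemma least_parameter:
  fixes A :: "'m::finite \<Rightarrow> real^'n^'n"
  assumes sym: "\<And>i. transpose (A i) = A i" and nonempty: "sol_set A b c \<noteq> {}" and uv: "u \<noteq> v"
    and al: "\<alpha> \<in> Omega_segment A b c u v"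
  shows "least_parameter A b c u v \<in> Omega_segment A b c u v" "least_parameter A b c u v \<le> \<alpha>"
proof -
  note compact = compact_Omega_segment[OF sym nonempty uv]
  have "bdd_below (Omega_segment A b c u v)"
    using compact by (intro bounded_imp_bdd_below compact_imp_bounded)
  then show "least_parameter A b c u v \<in> Omega_segment A b c u v" "least_parameter A b c u v \<le> \<alpha>"
    using al compact closed_contains_Inf[of "Omega_segment A b c u v"]
    by (auto simp: least_parameter_def compact_imp_closed intro: cInf_lower)
qed

lemma det_least_parameter:
  fixes A :: "'m::finite \<Rightarrow> real^'n^'n"
  assumes sym: "\<And>i. transpose (A i) = A i" and nonempty: "sol_set A b c \<noteq> {}" and uv: "u \<noteq> v"
    and ne: "Omega_segment A b c u v \<noteq> {}" and pos: "0 < least_parameter A b c u v"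
  defines "\<alpha> \<equiv> least_parameter A b c u v"
  shows "det (\<alpha> *\<^sub>R hom_mat (A u) (b u) (c u) + (1 - \<alpha>) *\<^sub>R hom_mat (A v) (b v) (c v)) = 0"
proof (rule ccontr)
  assume det: "det (\<alpha> *\<^sub>R hom_mat (A u) (b u) (c u)
      + (1 - \<alpha>) *\<^sub>R hom_mat (A v) (b v) (c v)) \<noteq> 0"
  have al: "\<alpha> \<in> Omega_segment A b c u v"
    using least_parameter(1)[OF sym nonempty uv] ne by (auto simp: \<alpha>_def)
  obtain e where e: "e > 0"
    "\<And>t. \<bar>t\<bar> \<le> e \<Longrightarrow> \<alpha> + t \<in> {0..1} \<Longrightarrow> \<alpha> + t \<in> Omega_segment A b c u v"
    using Omega_segment_nonsingular_interior[OF sym nonempty uv al det] by blast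
  \<comment> \<open>The step to the left is cut at \<open>\<alpha>\<close> in order to stay in \<open>[0, 1]\<close>.\<close>
  define t where "t = - min e \<alpha>"
  have t: "t < 0" "\<bar>t\<bar> \<le> e" "0 \<le> \<alpha> + t"
    using e(1) pos by (auto simp: t_def \<alpha>_def)
  then have "\<alpha> + t \<in> Omega_segment A b c u v"
    using al e(2)[of t] by (auto simp: Omega_segment_def)
  then have "\<alpha> \<le> \<alpha> + t"
    unfolding \<alpha>_def by (rule least_parameter(2)[OF sym nonempty uv])
  then show False using t by simp
qed

text \<open>
  The aggregated function at \<open>y\<close> is affine in the parameter, hence at the least or at the greatest
  parameter its value is at least the one at \<open>\<alpha>\<close>.
\<close>

lemma exists_least_parameter_separating:
  fixes A :: "'m::finite \<Rightarrow> real^'n^'n"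
  assumes sym: "\<And>i. transpose (A i) = A i" and nonempty: "sol_set A b c \<noteq> {}" and uv: "u \<noteq> v"
    and al: "\<alpha> \<in> Omega_segment A b c u v"
    and y: "y \<notin> agg_set A b c (segment_point u v \<alpha>)"
  shows "(Omega_segment A b c u v \<noteq> {} \<and>
      y \<notin> agg_set A b c (segment_point u v (least_parameter A b c u v))) \<or>
    (Omega_segment A b c v u \<noteq> {} \<and>
      y \<notin> agg_set A b c (segment_point v u (least_parameter A b c v u)))"
proof -
  define p q where "p = quad_fun (A u) (b u) (c u) y" and "q = quad_fun (A v) (b v) (c v) y"
  have val: "y \<in> agg_set A b c (segment_point u v \<beta>) \<longleftrightarrow> \<beta> * p + (1 - \<beta>) * q < 0" for \<beta>
    by (simp add: agg_set_eq_homog agg_mat_segment_point lincomb_form quad_fun_eq_homog p_def q_def)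
  have al': "1 - \<alpha> \<in> Omega_segment A b c v u" using al by (simp add: Omega_segment_swap)
  define \<alpha>\<^sub>0 where "\<alpha>\<^sub>0 = least_parameter A b c u v"
  define \<alpha>\<^sub>1 where "\<alpha>\<^sub>1 = 1 - least_parameter A b c v u"
  have "\<alpha>\<^sub>0 \<le> \<alpha>" "\<alpha> \<le> \<alpha>\<^sub>1"
    using least_parameter(2)[OF sym nonempty uv al]
      least_parameter(2)[OF sym nonempty uv[symmetric] al'] by (simp_all add: \<alpha>\<^sub>0_def \<alpha>\<^sub>1_def)
  then have "\<alpha> * (p - q) \<le> \<alpha>\<^sub>1 * (p - q) \<or> \<alpha> * (p - q) \<le> \<alpha>\<^sub>0 * (p - q)"
    by (cases "p \<ge> q") (auto intro: mult_right_mono mult_right_mono_neg)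
  then have "0 \<le> \<alpha>\<^sub>0 * p + (1 - \<alpha>\<^sub>0) * q \<or> 0 \<le> \<alpha>\<^sub>1 * p + (1 - \<alpha>\<^sub>1) * q"
    using y unfolding val by (auto simp: algebra_simps)
  then have "y \<notin> agg_set A b c (segment_point u v \<alpha>\<^sub>0)
      \<or> y \<notin> agg_set A b c (segment_point u v \<alpha>\<^sub>1)"
    by (auto simp: val)
  moreover have "segment_point u v \<alpha>\<^sub>1 = segment_point v u (least_parameter A b c v u)"
    by (simp add: \<alpha>\<^sub>1_def segment_point_swap)
  ultimately show ?thesis using al al' by (auto simp: \<alpha>\<^sub>0_def)
qed

lemma card_off_diagonal: "card {p :: 'm \<times> 'm::finite. fst p \<noteq> snd p} = CARD('m)\<^sup>2 - CARD('m)"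
proof -
  have "{p :: 'm \<times> 'm. fst p \<noteq> snd p} = UNIV - range (\<lambda>x. (x, x))" by auto
  moreover have "card (range (\<lambda>x::'m. (x, x))) = CARD('m)" by (simp add: card_image inj_on_def)
  ultimately show ?thesis by (simp add: card_Diff_subset power2_eq_square)
qed

theorem theorem2p18:
  fixes A :: "'m::finite \<Rightarrow> real^'n^'n"
    and b :: "'m \<Rightarrow> real^'n"
    and c :: "'m \<Rightarrow> real"
  defines "Q \<equiv> \<lambda>i. hom_mat (A i) (b i) (c i)"
  assumes n: "CARD('n) \<ge> 3"
    and m: "CARD('m) \<ge> 2"
    and sym: "\<And>i. transpose (A i) = A i"
    and nonempty: "sol_set A b c \<noteq> {}"
    and proper: "convex hull (sol_set A b c) \<noteq> UNIV"
    and hhc: "hidden_hyperplane_convex (hom_quad_map A b c)"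
    and pd: "\<And>i j k. i \<noteq> j \<Longrightarrow> i \<noteq> k \<Longrightarrow> j \<noteq> k \<Longrightarrow>
               \<exists>p q r. pos_definite (p *\<^sub>R Q i + q *\<^sub>R Q j + r *\<^sub>R Q k)"
  shows "\<exists>(r::nat) (l :: nat \<Rightarrow> real^'m).
           r \<le> CARD('m)^2 - CARD('m) \<and>
           (\<forall>i\<in>{1..r}. l i \<in> Omega2 A b c) \<and>
           convex hull (sol_set A b c) = (\<Inter>i\<in>{1..r}. agg_set A b c (l i)) \<and>
           (\<forall>u v. u \<noteq> v \<longrightarrow>
              card {i\<in>{1..r}. support (l i) = {u, v}} \<le> 2 \<and>
              (\<forall>i\<in>{1..r}. support (l i) = {u, v} \<longrightarrow>
                 (\<exists>\<alpha>. det (\<alpha> *\<^sub>R Q u + (1 - \<alpha>) *\<^sub>R Q v) = 0 \<and>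
                      l i = \<alpha> *\<^sub>R axis u 1 + (1 - \<alpha>) *\<^sub>R axis v 1)))"
proof -
  define g where "g = (\<lambda>(u, v). segment_point u v (least_parameter A b c u v))"
  \<comment> \<open>An extreme aggregation may have the whole space as its set; removing it does not change the intersection.\<close>
  define L where "L = g ` {(u, v). u \<noteq> v \<and> Omega_segment A b c u v \<noteq> {}} \<inter> Omega1 A b c"
  have gL: "x \<in> L \<Longrightarrow> \<exists>u v. x = segment_point u v (least_parameter A b c u v) \<and> u \<noteq> v
      \<and> Omega_segment A b c u v \<noteq> {} \<and> x \<in> Omega1 A b c" for x
    by (auto simp: L_def g_def)
  have fin: "finite L" by (simp add: L_def)
  have "card L \<le> card (g ` {p. fst p \<noteq> snd p})"
    by (intro card_mono) (auto simp: L_def)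
  also have "\<dots> \<le> CARD('m)\<^sup>2 - CARD('m)"
    unfolding card_off_diagonal[symmetric] by (intro card_image_le) simp
  finally have card_L: "card L \<le> CARD('m)\<^sup>2 - CARD('m)" .

  have L_Omega2: "L \<subseteq> Omega2 A b c"
  proof
    fix x assume "x \<in> L"
    then obtain u v where uv: "x = segment_point u v (least_parameter A b c u v)" "u \<noteq> v"
        "x \<in> Omega1 A b c" using gL by blast
    have "card (support x) \<le> card {u, v}"
      using support_segment_point[OF uv(2)] by (intro card_mono) (auto simp: uv(1))
    then show "x \<in> Omega2 A b c" using uv by (simp add: Omega2_def)
  qed

  have hull: "convex hull (sol_set A b c) = (\<Inter>x\<in>L. agg_set A b c x)"
  proof
    show "convex hull (sol_set A b c) \<subseteq> (\<Inter>x\<in>L. agg_set A b c x)"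
      by (auto simp: L_def Omega1_def Omega_def)
    have "\<exists>x\<in>L. y \<notin> agg_set A b c x" if y: "y \<notin> convex hull (sol_set A b c)" for y
    proof -
      obtain h l0 where h: "\<And>x. x \<in> sol_set A b c \<Longrightarrow> 0 < h \<bullet> homog x" "h \<bullet> homog y = 0"
        and l0: "\<And>i. 0 \<le> l0 $ i" "l0 \<noteq> 0" "psd_on_hyperplane (agg_mat A b c l0) h"
        using exists_separating_aggregation[OF nonempty hhc y] by blast
      obtain l where l: "\<And>i. 0 \<le> l $ i" "l \<noteq> 0" "psd_on_hyperplane (agg_mat A b c l) h"
        "card (support l) \<le> 2"
        using reduce_support[OF nonempty pd[unfolded Q_def] homog_nonzero h(2) l0] by blast
      \<comment> \<open>A support with one element is enlarged to a pair; the parameter is then 0 or 1.\<close>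
      obtain B where B: "support l \<subseteq> B" "card B = 2"
        using exists_subset_between[of "support l" 2 UNIV] l(4) m by auto
      then obtain u v where uv: "u \<noteq> v" "support l \<subseteq> {u, v}" by (auto simp: card_2_iff)
      define s where "s = l $ u + l $ v"
      have off: "l $ i = 0" if "i \<noteq> u" "i \<noteq> v" for i
        using that uv(2) l(1)[of i] by (force simp: support_def)
      have "s \<noteq> 0"
      proof
        assume "s = 0"
        then have "l $ u = 0" "l $ v = 0" using l(1)[of u] l(1)[of v] by (simp_all add: s_def)
        then have "l $ i = 0" for i using off by metis
        then show False using l(2) by (simp add: vec_eq_iff)
      qed
      then have s: "s > 0" using l(1)[of u] l(1)[of v] by (simp add: s_def)
      define \<alpha> where "\<alpha> = l $ u / s"
      have "1 - \<alpha> = l $ v / s" using s by (simp add: \<alpha>_def s_def field_simps)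
      then have seg: "segment_point u v \<alpha> = (1 / s) *\<^sub>R l + 0 *\<^sub>R l"
        using off by (auto simp: vec_eq_iff segment_point_nth[OF uv(1)] \<alpha>_def)
      have psd: "psd_on_hyperplane (agg_mat A b c (segment_point u v \<alpha>)) h"
        using l(3) s unfolding seg agg_mat_lincomb psd_on_hyperplane_def lincomb_form by simp
      have "\<alpha> \<in> {0..1}"
        using l(1)[of u] l(1)[of v] s by (simp add: \<alpha>_def s_def)
      then have al: "\<alpha> \<in> Omega_segment A b c u v"
        using h(1) psd by (auto simp: Omega_segment_iff[OF sym nonempty uv(1)])
      have "y \<notin> agg_set A b c (segment_point u v \<alpha>)"
        using psd h(2) by (auto simp: psd_on_hyperplane_def agg_set_eq_homog not_less)
      from exists_least_parameter_separating[OF sym nonempty uv(1) al this]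
      have "(Omega_segment A b c u v \<noteq> {} \<and> y \<notin> agg_set A b c (g (u, v))) \<or>
          (Omega_segment A b c v u \<noteq> {} \<and> y \<notin> agg_set A b c (g (v, u)))"
        unfolding g_def prod.case .
      then obtain u' v' where uv': "u' \<noteq> v'" "Omega_segment A b c u' v' \<noteq> {}"
          "y \<notin> agg_set A b c (g (u', v'))"
        using uv(1) by metis
      then have "g (u', v') \<in> Omega A b c"
        using least_parameter(1)[OF sym nonempty uv'(1)]
        by (auto simp: g_def Omega_segment_def)
      then have "g (u', v') \<in> L" using uv' by (auto simp: L_def Omega1_def)
      then show ?thesis using uv'(3) by blast
    qed
    then show "(\<Inter>x\<in>L. agg_set A b c x) \<subseteq> convex hull (sol_set A b c)" by blast
  qed

  have L_pair: "x = g (u, v) \<or> x = g (v, u)"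
      "\<exists>\<alpha>. det (\<alpha> *\<^sub>R Q u + (1 - \<alpha>) *\<^sub>R Q v) = 0 \<and> x = segment_point u v \<alpha>"
    if x: "x \<in> L" "support x = {u, v}" and uv: "u \<noteq> v" for x u v
  proof -
    obtain u' v' where x': "x = segment_point u' v' (least_parameter A b c u' v')" "u' \<noteq> v'"
      "Omega_segment A b c u' v' \<noteq> {}" using gL[OF x(1)] by blast
    let ?\<alpha> = "least_parameter A b c u' v'"
    \<comment> \<open>The pair is determined by the support up to order, and a full support makes the parameter positive.\<close>
    have "{u, v} \<subseteq> {u', v'}" using support_segment_point[OF x'(2)] x(2) x'(1) by metis
    then have uv': "u' = u \<and> v' = v \<or> u' = v \<and> v' = u" using uv by (auto simp: doubleton_eq_iff)
    then show "x = g (u, v) \<or> x = g (v, u)" using x' by (auto simp: g_def)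
    have "u' \<in> support x" using x(2) uv' by auto
    then have "0 < ?\<alpha>" by (simp add: x'(1) support_def segment_point_nth[OF x'(2)])
    then have det: "det (?\<alpha> *\<^sub>R Q u' + (1 - ?\<alpha>) *\<^sub>R Q v') = 0"
      unfolding Q_def by (intro det_least_parameter sym nonempty x')
    from uv' show "\<exists>\<alpha>. det (\<alpha> *\<^sub>R Q u + (1 - \<alpha>) *\<^sub>R Q v) = 0 \<and> x = segment_point u v \<alpha>"
    proof
      assume "u' = u \<and> v' = v"
      then show ?thesis using det x'(1) by blast
    next
      assume "u' = v \<and> v' = u"
      then show ?thesis
        using det x'(1) segment_point_swap[of u v ?\<alpha>]
        by (intro exI[of _ "1 - ?\<alpha>"]) (simp add: add.commute)
    qed
  qed

  obtain l where l: "bij_betw l {1..card L} L"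
    using ex_bij_betw_nat_finite_1[OF fin] by blast
  have lL: "l ` {1..card L} = L" using l by (simp add: bij_betw_def)
  have card_pair: "card {i\<in>{1..card L}. support (l i) = {u, v}} \<le> 2" if uv: "u \<noteq> v" for u v
  proof -
    let ?I = "{i\<in>{1..card L}. support (l i) = {u, v}}"
    have sub: "l ` ?I \<subseteq> {g (u, v), g (v, u)}"
      using lL L_pair(1)[OF _ _ uv] by blast
    have "inj_on l ?I" using l by (auto simp: bij_betw_def intro: inj_on_subset)
    then have "card ?I = card (l ` ?I)" by (simp add: card_image)
    also have "\<dots> \<le> card {g (u, v), g (v, u)}"
      using sub by (intro card_mono) simp_all
    also have "\<dots> \<le> 2" by (simp add: card_insert_if)
    finally show ?thesis .
  qed
  show ?thesis
  proof (intro exI[of _ "card L"] exI[of _ l] conjI allI impI ballI)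
    show "convex hull (sol_set A b c) = (\<Inter>i\<in>{1..card L}. agg_set A b c (l i))"
    proof -
      have "agg_set A b c ` L = (\<lambda>i. agg_set A b c (l i)) ` {1..card L}"
        using arg_cong[OF lL, of "image (agg_set A b c)"] by (simp only: image_image)
      then show ?thesis using hull by (simp only:)
    qed
    fix u v :: 'm and i assume "u \<noteq> v" "i \<in> {1..card L}" "support (l i) = {u, v}"
    then show "\<exists>\<alpha>. det (\<alpha> *\<^sub>R Q u + (1 - \<alpha>) *\<^sub>R Q v) = 0 \<and>
        l i = \<alpha> *\<^sub>R axis u 1 + (1 - \<alpha>) *\<^sub>R axis v 1"
      using L_pair(2) lL unfolding segment_point_def by blast
  qed (use card_L L_Omega2 lL card_pair in auto)
qed

end
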